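(* Let $\alpha>0$ and let $f:S^n\times\Gamma_+^{n\times n}\to\mathbb{R}$ be a positive function which is $\mathrm{SO}(n)$-invariant, monotone non-decreasing and inverse-concave in its second entry. (a) Let $\Omega\subset\mathbb{R}^{n+1}$ be a bounded, convex, open set with smooth boundary and let $u_0\in\mathbb{R}$. Suppose that $u\in C^1(\overline\Omega)$ has a single critical point, $p\in\Omega$, is smooth in $\Omega\setminus\{p\}$, and satisfies $$|Du|\,f^\alpha\left(-\frac{Du}{|Du|},-\frac{1}{|Du|}\left[I-\frac{Du\otimes Du}{|Du|^2}\right]\cdot D^2u\right)=1\ \text{ in }\Omega\setminus\{p\},\qquad u=u_0\ \text{ on }\partial\Omega.$$ Then $w:=((1+\alpha)(u-u_0))^{\frac{1}{1+\alpha}}$ is concave. (b) Let $\Omega\subset\mathbb{R}^{n+1}$ be a convex, open set with smooth (possibly empty) boundary, not necessarily bounded. Suppose that $u\in C^1(\Omega)$ has a single critical point, $p\in\Omega$, is smooth in $\Omega\setminus\{p\}$, satisfies $$|Du|\,f^\alpha\left(-\frac{Du}{|Du|},-\frac{1}{|Du|}\left[I-\frac{Du\otimes Du}{|Du|^2}\right]\cdot D^2u\right)=1\ \text{ in }\Omega\setminus\{p\},$$ satisfies the boundary condition $u=-\infty$ on $\partial\Omega$, and has bounded level sets. Then $u$ is concave.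
   Context: $S^n\subset\mathbb{R}^{n+1}$ is the unit sphere and $\Gamma_+^{n\times n}$ is the cone of positive definite symmetric $n\times n$ matrices. $f$ is $\mathrm{SO}(n)$-invariant if $f(p,OrO^{-1})=f(p,r)$ for all $O\in\mathrm{SO}(n)$; monotone non-decreasing in its second entry if $r\ge s$ (i.e. $r-s$ positive semi-definite) implies $f(p,r)\ge f(p,s)$; and inverse-concave if the dual function $f_\ast:S^n\times\Gamma_+^{n\times n}\to\mathbb{R}$ defined by $f_\ast(p,r):=1/f(p,r^{-1})$ is concave in its second entry $r$, for each fixed $p$. No regularity of $f$ is assumed. At a point where $Du\ne0$, the second argument of $f$ in the equation denotes the $n\times n$ component matrix, with respect to any orthonormal basis of the $n$-dimensional hyperplane $Du^\perp$, of the restriction to $Du^\perp$ of the endomorphism $-\frac{1}{|Du|}\left[I-\frac{Du\otimes Du}{|Du|^2}\right]\cdot D^2u$ (by $\mathrm{SO}(n)$-invariance, the value of $f$ does not depend on the choice of orthonormal basis); that $u$ satisfies the equation includes the requirement that this matrix lies in $\Gamma_+^{n\times n}$. In (b), $u=-\infty$ on $\partial\Omega$ means that $u(x)\to-\infty$ as $x$ tends to any point of $\partial\Omega$ (a vacuous condition if $\partial\Omega=\emptyset$), and "bounded level sets" means that for every $t<u(p)$ the set $\{q\in\Omega:u(q)>t\}$ bounded by the level set $\{u=t\}$ is bounded. *)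

theory Defs
  imports "HOL-Analysis.Analysis"
begin

section \<open>Matrices\<close>

definition positive_semidefinite :: "real^'n^'n \<Rightarrow> bool" where
  "positive_semidefinite r \<longleftrightarrow> transpose r = r \<and> (\<forall>v. 0 \<le> v \<bullet> (r *v v))"

definition Gamma_plus :: "(real^'n^'n) set" where
  "Gamma_plus = {r. transpose r = r \<and> (\<forall>v. v \<noteq> 0 \<longrightarrow> 0 < v \<bullet> (r *v v))}"

definition outer :: "real^'m \<Rightarrow> real^'m \<Rightarrow> real^'m^'m" where
  "outer a b = (\<chi> i j. a $ i * b $ j)"

section \<open>Conditions on the speed function\<close>

text \<open>
  A function on the product of the unit sphere with \<^const>\<open>Gamma_plus\<close> is represented by a total
  function; only its values on that product are ever constrained or used.
\<close>

definition positive_speed :: "(real^'m \<Rightarrow> real^'n^'n \<Rightarrow> real) \<Rightarrow> bool" where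
  "positive_speed f \<longleftrightarrow> (\<forall>p\<in>sphere 0 1. \<forall>r\<in>Gamma_plus. 0 < f p r)"

definition SO_invariant :: "(real^'m \<Rightarrow> real^'n^'n \<Rightarrow> real) \<Rightarrow> bool" where
  "SO_invariant f \<longleftrightarrow>
     (\<forall>p\<in>sphere 0 1. \<forall>r\<in>Gamma_plus. \<forall>Q. rotation_matrix Q \<longrightarrow>
        f p (Q ** r ** matrix_inv Q) = f p r)"

definition monotone_second :: "(real^'m \<Rightarrow> real^'n^'n \<Rightarrow> real) \<Rightarrow> bool" where
  "monotone_second f \<longleftrightarrow>
     (\<forall>p\<in>sphere 0 1. \<forall>r\<in>Gamma_plus. \<forall>s\<in>Gamma_plus.
        positive_semidefinite (r - s) \<longrightarrow> f p s \<le> f p r)"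

definition dual_speed :: "(real^'m \<Rightarrow> real^'n^'n \<Rightarrow> real) \<Rightarrow> real^'m \<Rightarrow> real^'n^'n \<Rightarrow> real" where
  "dual_speed f p r = 1 / f p (matrix_inv r)"

definition inverse_concave :: "(real^'m \<Rightarrow> real^'n^'n \<Rightarrow> real) \<Rightarrow> bool" where
  "inverse_concave f \<longleftrightarrow> (\<forall>p\<in>sphere 0 1. concave_on Gamma_plus (dual_speed f p))"

section \<open>Regularity\<close>

text \<open>Meaningful for open \<open>S\<close>, where the derivatives are two-sided.\<close>

primrec Ck_on :: "nat \<Rightarrow> 'a::euclidean_space set \<Rightarrow> ('a \<Rightarrow> real) \<Rightarrow> bool" where
  "Ck_on 0 S g \<longleftrightarrow> continuous_on S g"
| "Ck_on (Suc k) S g \<longleftrightarrow>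
     (\<forall>x\<in>S. g differentiable (at x)) \<and>
     (\<forall>v. Ck_on k S (\<lambda>x. frechet_derivative g (at x) v))"

definition smooth_on :: "'a::euclidean_space set \<Rightarrow> ('a \<Rightarrow> real) \<Rightarrow> bool" where
  "smooth_on S g \<longleftrightarrow> (\<forall>k. Ck_on k S g)"

text \<open>
  For open \<open>\<Omega>\<close>: near each boundary point \<open>\<Omega>\<close> is a sublevel set of a smooth function without
  critical points, so it lies locally on one side of a smooth hypersurface.
\<close>

definition smooth_boundary :: "'a::euclidean_space set \<Rightarrow> bool" where
  "smooth_boundary \<Omega> \<longleftrightarrow>
     (\<forall>q\<in>frontier \<Omega>. \<exists>U \<phi>. open U \<and> q \<in> U \<and> smooth_on U \<phi> \<and>
        (\<forall>x\<in>U. frechet_derivative \<phi> (at x) \<noteq> (\<lambda>v. 0)) \<and>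
        \<Omega> \<inter> U = {x\<in>U. \<phi> x < 0})"

text \<open>
  The gradient field \<open>Du\<close> is an explicit argument. It is determined by \<open>u\<close> on \<open>\<Omega>\<close> and, in
  the second definition, on \<open>closure \<Omega>\<close> by continuous extension.
\<close>

definition C1_on :: "'a::euclidean_space set \<Rightarrow> ('a \<Rightarrow> real) \<Rightarrow> ('a \<Rightarrow> 'a) \<Rightarrow> bool" where
  "C1_on \<Omega> u Du \<longleftrightarrow> (\<forall>x\<in>\<Omega>. GDERIV u x :> Du x) \<and> continuous_on \<Omega> Du"

definition C1_on_closure :: "'a::euclidean_space set \<Rightarrow> ('a \<Rightarrow> real) \<Rightarrow> ('a \<Rightarrow> 'a) \<Rightarrow> bool" where
  "C1_on_closure \<Omega> u Du \<longleftrightarrow>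
     (\<forall>x\<in>\<Omega>. GDERIV u x :> Du x) \<and>
     continuous_on (closure \<Omega>) u \<and> continuous_on (closure \<Omega>) Du"

section \<open>The equation\<close>

text \<open>Here \<open>g\<close> stands for the gradient and \<open>H\<close> for the Hessian of \<open>u\<close> at a point.\<close>

definition level_set_endo :: "real^'m \<Rightarrow> real^'m^'m \<Rightarrow> real^'m^'m" where
  "level_set_endo g H =
     (- (1 / norm g)) *\<^sub>R ((mat 1 - (1 / (norm g)\<^sup>2) *\<^sub>R outer g g) ** H)"

definition onb_of_perp :: "real^'m \<Rightarrow> ('n::finite \<Rightarrow> real^'m) \<Rightarrow> bool" where
  "onb_of_perp g e \<longleftrightarrow>
     (\<forall>i j. e i \<bullet> e j = (if i = j then 1 else 0)) \<and> span (range e) = orthogonal_comp {g}"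

definition component_matrix :: "('n::finite \<Rightarrow> real^'m) \<Rightarrow> real^'m^'m \<Rightarrow> real^'n^'n" where
  "component_matrix e A = (\<chi> i j. e i \<bullet> (A *v e j))"

definition satisfies_equation ::
    "(real^'m \<Rightarrow> real^'n^'n \<Rightarrow> real) \<Rightarrow> real \<Rightarrow> (real^'m \<Rightarrow> real^'m) \<Rightarrow> (real^'m) set \<Rightarrow> bool" where
  "satisfies_equation f \<alpha> Du D \<longleftrightarrow>
     (\<forall>x\<in>D. \<forall>e::'n \<Rightarrow> real^'m. onb_of_perp (Du x) e \<longrightarrow>
        (let r = component_matrix e (level_set_endo (Du x) (jacobian Du (at x)))
         in r \<in> Gamma_plus \<and>
            norm (Du x) * f (- (Du x /\<^sub>R norm (Du x))) r powr \<alpha> = 1))"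

end

theory Submission
  imports Defs
begin

text \<open>
  For (a), suppose that \<open>W = ((1 + \<alpha>)(u - u\<^sub>0))\<^bsup>1/(1 + \<alpha>)\<^esup>\<close> violates concavity with weights
  \<open>1 - t, t\<close>, and minimise \<open>W((1 - t)x + ty) - (1 - t)W(x) - tW(y)\<close> over pairs of points. Since
  \<open>W\<close> has infinite slope at the boundary, the minimum is interior, so \<open>DW\<close> takes the same value
  \<open>\<xi>\<close> at \<open>x\<close>, \<open>y\<close> and \<open>z = (1 - t)x + ty\<close>. If \<open>\<xi> = 0\<close> the three points coincide. Otherwise the second-order
  condition in the directions orthogonal to \<open>\<xi>\<close> bounds the second fundamental form at \<open>z\<close> by the
  weighted harmonic mean of those at \<open>x\<close> and \<open>y\<close>; as the equation reads
  \<open>1/f = |\<xi>|\<^bsup>1/\<alpha>\<^esup> W\<close>, monotonicity and inverse-concavity give \<open>W(z) \<ge> (1 - t)W(x) + tW(y)\<close>.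

  For (b), the superlevel sets \<open>{u > T}\<close> are convex, and (a) applied to them gives concavity of
  \<open>((1 + \<alpha>)(u - T))\<^bsup>1/(1 + \<alpha>)\<^esup>\<close>. Concavity of \<open>u\<close> is the limit \<open>T \<rightarrow> -\<infinity>\<close>.
\<close>

section \<open>Positive definite matrices\<close>

lemma transpose_eq_iff_inner:
  fixes A :: "real^'n^'n"
  shows "transpose A = A \<longleftrightarrow> (\<forall>a b. a \<bullet> (A *v b) = (A *v a) \<bullet> b)"
proof
  assume t: "transpose A = A"
  show "\<forall>a b. a \<bullet> (A *v b) = (A *v a) \<bullet> b"
  proof (intro allI)
    fix a b
    have "a \<bullet> (A *v b) = (a v* A) \<bullet> b" by (rule dot_lmul_matrix[symmetric])
    also have "a v* A = transpose A *v a" by (rule transpose_matrix_vector[symmetric])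
    finally show "a \<bullet> (A *v b) = (A *v a) \<bullet> b" unfolding t .
  qed
next
  assume h: "\<forall>a b. a \<bullet> (A *v b) = (A *v a) \<bullet> b"
  have "transpose A *v a = A *v a" for a
  proof -
    have "(transpose A *v a) \<bullet> b = (A *v a) \<bullet> b" for b
      using h by (simp only: transpose_matrix_vector dot_lmul_matrix)
    then show ?thesis by (metis vector_eq_rdot)
  qed
  then show "transpose A = A"
    by (simp add: matrix_eq del: transpose_matrix_vector)
qed

lemma Gamma_plus_iff_inner:
  "A \<in> Gamma_plus \<longleftrightarrow>
     (\<forall>a b. a \<bullet> (A *v b) = (A *v a) \<bullet> b) \<and> (\<forall>v. v \<noteq> 0 \<longrightarrow> 0 < v \<bullet> (A *v v))"
  by (simp add: Gamma_plus_def transpose_eq_iff_inner)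

lemma Gamma_plus_matrix_inv:
  assumes "A \<in> Gamma_plus"
  shows "A *v (matrix_inv A *v v) = v" "matrix_inv A *v (A *v v) = v"
    and "matrix_inv A \<in> Gamma_plus" "matrix_inv (matrix_inv A) = A"
proof -
  have sym: "a \<bullet> (A *v b) = (A *v a) \<bullet> b" and pos: "v \<noteq> 0 \<Longrightarrow> 0 < v \<bullet> (A *v v)" for a b v
    using assms by (auto simp: Gamma_plus_iff_inner)
  have "\<forall>x. A *v x = 0 \<longrightarrow> x = 0"
    using pos by fastforce
  then have "\<exists>A'. A ** A' = mat 1 \<and> A' ** A = mat 1"
    using invertible_left_inverse matrix_left_invertible_ker unfolding invertible_def by blast
  then have inv: "A ** matrix_inv A = mat 1" "matrix_inv A ** A = mat 1"
    unfolding matrix_inv_def by (metis (mono_tags, lifting) someI_ex)+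
  show 1: "A *v (matrix_inv A *v v) = v" for v
    by (simp add: matrix_vector_mul_assoc inv)
  show 2: "matrix_inv A *v (A *v v) = v" for v
    by (simp add: matrix_vector_mul_assoc inv)
  have "a \<bullet> (matrix_inv A *v b) = (matrix_inv A *v a) \<bullet> b" for a b
    by (metis 1 sym)
  moreover have "0 < v \<bullet> (matrix_inv A *v v)" if "v \<noteq> 0" for v
  proof -
    have "matrix_inv A *v v \<noteq> 0"
      using 1[of v] that by auto
    from pos[OF this] show ?thesis
      by (simp add: 1 inner_commute)
  qed
  ultimately show "matrix_inv A \<in> Gamma_plus"
    by (simp add: Gamma_plus_iff_inner)
  have "\<exists>B. matrix_inv A ** B = mat 1 \<and> B ** matrix_inv A = mat 1"
    using inv by blast
  then have "matrix_inv A ** matrix_inv (matrix_inv A) = mat 1"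
    unfolding matrix_inv_def[of "matrix_inv A"] by (metis (mono_tags, lifting) someI_ex)
  then show "matrix_inv (matrix_inv A) = A"
    by (metis inv(1) matrix_mul_assoc matrix_mul_lid matrix_mul_rid)
qed

text \<open>
  The hypothesis says that the quadratic form of \<open>C\<close> lies below the inf-convolution of those of
  \<open>A\<close> and \<open>B\<close>; minimising over \<open>a\<close> and \<open>b\<close> it becomes
  \<open>C \<le> ((1 - t) A\<^sup>-\<^sup>1 + t B\<^sup>-\<^sup>1)\<^sup>-\<^sup>1\<close>.
\<close>

lemma inverse_concave_harmonic:
  fixes A B C :: "real^'n^'n"
  assumes f: "positive_speed f" "monotone_second f" "inverse_concave f"
    and p: "p \<in> sphere 0 1"
    and ABC: "A \<in> Gamma_plus" "B \<in> Gamma_plus" "C \<in> Gamma_plus"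
    and t: "0 < t" "t < 1"
    and le: "\<And>a b. ((1 - t) *\<^sub>R a + t *\<^sub>R b) \<bullet> (C *v ((1 - t) *\<^sub>R a + t *\<^sub>R b))
               \<le> (1 - t) * (a \<bullet> (A *v a)) + t * (b \<bullet> (B *v b))"
  shows "(1 - t) / f p A + t / f p B \<le> 1 / f p C"
proof -
  define M where "M = (1 - t) *\<^sub>R matrix_inv A + t *\<^sub>R matrix_inv B"
  note iA = Gamma_plus_matrix_inv[OF ABC(1)]
  note iB = Gamma_plus_matrix_inv[OF ABC(2)]
  have conc: "concave_on Gamma_plus (dual_speed f p)"
    using f(3) p by (auto simp: inverse_concave_def)
  \<comment> \<open>Convexity of the domain is part of \<open>concave_on\<close>, so the mean
    \<open>M\<close> of the two inverses stays in \<open>Gamma_plus\<close>.\<close>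
  then have "convex (Gamma_plus :: (real^'n^'n) set)"
    by (simp add: concave_on_iff)
  then have M: "M \<in> Gamma_plus"
    unfolding M_def using iA(3) iB(3) t by (simp add: convexD_alt)
  note iM = Gamma_plus_matrix_inv[OF M]
  have "v \<bullet> (C *v v) \<le> v \<bullet> (matrix_inv M *v v)" for v
  proof -
    \<comment> \<open>The hypothesis \<open>le\<close> is applied at the minimisers
      \<open>a = A^-1 k\<close> and \<open>b = B^-1 k\<close>: they combine to \<open>v\<close>, and
      \<open>A\<close> and \<open>B\<close> send both to the same covector \<open>k\<close>.\<close>
    define k where "k = matrix_inv M *v v"
    have v: "v = (1 - t) *\<^sub>R (matrix_inv A *v k) + t *\<^sub>R (matrix_inv B *v k)"
      using iM(1)[of v]
      by (simp add: k_def M_def matrix_vector_mult_add_rdistrib scaleR_matrix_vector_assoc)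
    have "v \<bullet> (C *v v) \<le> (1 - t) * ((matrix_inv A *v k) \<bullet> k) + t * ((matrix_inv B *v k) \<bullet> k)"
      using le[of "matrix_inv A *v k" "matrix_inv B *v k"] v by (simp add: iA(1) iB(1))
    also have "\<dots> = v \<bullet> k"
      by (subst v) (simp add: inner_add_left)
    finally show ?thesis by (simp add: k_def)
  qed
  moreover have "transpose (matrix_inv M - C) = matrix_inv M - C"
    using iM(3) ABC(3) by (simp add: Gamma_plus_def transpose_def vec_eq_iff)
  ultimately have "positive_semidefinite (matrix_inv M - C)"
    by (simp add: positive_semidefinite_def matrix_vector_mult_diff_rdistrib inner_diff_right)
  then have "f p C \<le> f p (matrix_inv M)"
    using f(2) p iM(3) ABC(3) by (auto simp: monotone_second_def)
  moreover have "0 < f p C"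
    using f(1) p ABC(3) by (auto simp: positive_speed_def)
  ultimately have "dual_speed f p M \<le> 1 / f p C"
    by (simp add: dual_speed_def frac_le)
  moreover have "(1 - t) * dual_speed f p (matrix_inv A) + t * dual_speed f p (matrix_inv B)
      \<le> dual_speed f p M"
    unfolding M_def using concave_onD[OF conc] iA(3) iB(3) t by simp
  ultimately show ?thesis
    by (simp add: dual_speed_def iA(4) iB(4))
qed

section \<open>The second fundamental form in an orthonormal frame\<close>

text \<open>The vector with coordinates \<open>v\<close> in the frame \<open>e\<close>; it carries
  vectors of R^n to the hyperplane on which the shape operator acts.\<close>

definition frame_comb :: "('n::finite \<Rightarrow> real^'m) \<Rightarrow> real^'n \<Rightarrow> real^'m" where
  "frame_comb e v = (\<Sum>i\<in>UNIV. (v $ i) *\<^sub>R e i)"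

lemma linear_frame_comb: "linear (frame_comb e)"
  by (rule linearI)
    (simp_all add: frame_comb_def scaleR_left_distrib sum.distrib scaleR_sum_right)

lemma orthogonal_comp_singleton: "orthogonal_comp {g} = {x. g \<bullet> x = 0}"
  by (auto simp: orthogonal_comp_def orthogonal_def)

lemma onb_of_perp_orthogonal: "onb_of_perp g e \<Longrightarrow> g \<bullet> e i = 0"
  using span_base[of "e i" "range e"] by (simp add: onb_of_perp_def orthogonal_comp_singleton)

lemma frame_comb_orthogonal: "onb_of_perp g e \<Longrightarrow> g \<bullet> frame_comb e v = 0"
  by (simp add: frame_comb_def inner_sum_right onb_of_perp_orthogonal)

lemma frame_comb_surj:
  assumes "onb_of_perp g e" "g \<bullet> h = 0"
  obtains v where "h = frame_comb e v"
proof -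
  have "e i \<in> range (frame_comb e)" for i
  proof
    show "e i = frame_comb e (axis i 1)"
      by (simp add: frame_comb_def axis_def if_distrib[of "\<lambda>c. c *\<^sub>R _"] sum.delta cong: if_cong)
  qed simp
  then have "span (range e) \<subseteq> range (frame_comb e)"
    by (intro span_minimal linear_subspace_image linear_frame_comb subspace_UNIV) auto
  moreover have "h \<in> span (range e)"
    using assms by (simp add: onb_of_perp_def orthogonal_comp_singleton)
  ultimately show ?thesis using that by auto
qed

text \<open>Lets one frame of the hyperplane orthogonal to \<xi> serve at several points whose
  gradients \<open>Du\<close> are different multiples of \<xi>.\<close>

lemma onb_of_perp_scale: "c \<noteq> 0 \<Longrightarrow> onb_of_perp (c *\<^sub>R g) e \<longleftrightarrow> onb_of_perp g e"
  by (simp add: onb_of_perp_def orthogonal_comp_singleton)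

text \<open>The equation is quantified over frames, so it says something only where a frame exists.
  The cardinality assumption makes the hyperplane n-dimensional, and an orthonormal basis of it can
  be indexed by \<open>'n\<close>.\<close>

lemma onb_of_perp_exists:
  fixes g :: "real^'m"
  assumes "CARD('m) = CARD('n) + 1" "g \<noteq> 0"
  shows "\<exists>e :: 'n::finite \<Rightarrow> real^'m. onb_of_perp g e"
proof -
  have sub: "subspace {x. g \<bullet> x = 0}" by (rule subspace_hyperplane)
  obtain B where B: "pairwise orthogonal B" "\<And>x. x \<in> B \<Longrightarrow> norm x = 1" "independent B"
      "card B = dim {x. g \<bullet> x = 0}" "span B = {x. g \<bullet> x = 0}"
    using orthonormal_basis_subspace[OF sub] by metis
  have "card B = CARD('n)"
    using assms by (simp add: B(4) dim_hyperplane)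
  moreover have "finite B"
    using B(3) independent_imp_finite by blast
  ultimately obtain e where e: "bij_betw e (UNIV :: 'n set) B"
    using finite_same_card_bij[of "UNIV :: 'n set" B] by auto
  have "e i \<bullet> e j = (if i = j then 1 else 0)" for i j
  proof (cases "i = j")
    case True
    have "norm (e i) = 1" using B(2) e by (auto simp: bij_betw_def)
    then show ?thesis using True by (simp add: norm_eq_1)
  next
    case False
    then have "e i \<noteq> e j" using e by (auto simp: bij_betw_def inj_on_def)
    then show ?thesis using B(1) e False
      by (auto simp: pairwise_def orthogonal_def bij_betw_def)
  qed
  moreover have "span (range e) = orthogonal_comp {g}"
    using e B(5) by (simp add: bij_betw_def orthogonal_comp_singleton)
  ultimately show ?thesis unfolding onb_of_perp_def by blast
qed

lemma inner_component_matrix: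
  "v \<bullet> (component_matrix e A *v v) = frame_comb e v \<bullet> (A *v frame_comb e v)"
proof -
  have "(component_matrix e A *v v) $ i = e i \<bullet> (A *v frame_comb e v)" for i
  proof -
    have "(component_matrix e A *v v) $ i = (\<Sum>j\<in>UNIV. (e i \<bullet> (A *v e j)) * v $ j)"
      by (simp only: component_matrix_def matrix_vector_mult_def vec_lambda_beta)
    also have "\<dots> = e i \<bullet> (\<Sum>j\<in>UNIV. v $ j *\<^sub>R (A *v e j))"
      by (simp only: inner_sum_right inner_scaleR_right mult.commute)
    also have "(\<Sum>j\<in>UNIV. v $ j *\<^sub>R (A *v e j)) = A *v frame_comb e v"
      unfolding frame_comb_def
      by (simp add: linear_sum[OF matrix_vector_mul_linear] matrix_vector_mult_scaleR)
    finally show ?thesis .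
  qed
  then have "v \<bullet> (component_matrix e A *v v) = (\<Sum>i\<in>UNIV. v $ i * (e i \<bullet> (A *v frame_comb e v)))"
    by (simp only: inner_vec_def[of v] inner_real_def)
  also have "\<dots> = frame_comb e v \<bullet> (A *v frame_comb e v)"
    by (simp only: frame_comb_def[of e v] inner_sum_left inner_scaleR_left)
  finally show ?thesis .
qed

lemma outer_mult: "outer g g *v w = (g \<bullet> w) *\<^sub>R g"
  by (simp add: outer_def inner_vec_def matrix_vector_mult_def vec_eq_iff sum_distrib_left mult_ac)

text \<open>The projection removes only a multiple of \<open>g\<close>, which pairs to zero with the
  tangent vector \<open>h\<close>.\<close>

lemma inner_level_set_endo:
  assumes "g \<bullet> h = 0"
  shows "h \<bullet> (level_set_endo g H *v w) = - (h \<bullet> (H *v w)) / norm g"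
proof -
  have "level_set_endo g H *v w = (- (1 / norm g)) *\<^sub>R
      (H *v w - (1 / (norm g)\<^sup>2) *\<^sub>R (outer g g *v (H *v w)))"
    unfolding level_set_endo_def scaleR_matrix_vector_assoc[symmetric]
      matrix_vector_mul_assoc[symmetric] matrix_vector_mult_diff_rdistrib matrix_vector_mul_lid ..
  then show ?thesis
    using assms by (simp add: inner_diff_right outer_mult inner_commute)
qed

lemma inner_shape_matrix:
  assumes "onb_of_perp g e"
  shows "v \<bullet> (component_matrix e (level_set_endo g H) *v v)
       = - (frame_comb e v \<bullet> (H *v frame_comb e v)) / norm g"
  by (simp add: inner_component_matrix inner_level_set_endo frame_comb_orthogonal assms)

section \<open>Derivatives along lines\<close>

text \<open>If \<open>d\<close> were negative, \<phi>' would vanish at 0 and be negative just to the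
  right, and the mean value theorem would push \<phi> below its minimum.\<close>

lemma second_derivative_nonneg_at_local_min:
  fixes \<phi> :: "real \<Rightarrow> real"
  assumes der: "\<forall>\<^sub>F s in nhds 0. (\<phi> has_real_derivative \<phi>' s) (at s)"
    and der2: "(\<phi>' has_real_derivative d) (at 0)"
    and min: "\<forall>\<^sub>F s in nhds 0. \<phi> 0 \<le> \<phi> s"
  shows "0 \<le> d"
proof (rule ccontr)
  assume "\<not> 0 \<le> d"
  then obtain e1 where e1: "e1 > 0" "\<And>h. 0 < h \<Longrightarrow> h < e1 \<Longrightarrow> \<phi>' h < \<phi>' 0"
    using DERIV_neg_dec_right[OF der2] by auto
  obtain e2 where e2: "e2 > 0"
      "\<And>s. dist s 0 < e2 \<Longrightarrow> (\<phi> has_real_derivative \<phi>' s) (at s) \<and> \<phi> 0 \<le> \<phi> s"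
    using eventually_conj[OF der min] unfolding eventually_nhds_metric by auto
  have "(\<phi> has_real_derivative \<phi>' 0) (at 0)"
    using e2(2)[of 0] e2(1) by simp
  then have "\<phi>' 0 = 0"
    by (rule DERIV_local_min[OF _ e2(1)]) (use e2(2) in \<open>auto simp: dist_real_def\<close>)
  define s where "s = min e1 e2 / 2"
  have s: "0 < s" "s < e1" "s < e2"
    using e1(1) e2(1) by (auto simp: s_def)
  have "\<exists>r>0. r < s \<and> \<phi> s - \<phi> 0 = (s - 0) * \<phi>' r"
    by (rule MVT2) (use s e2(2) in \<open>auto simp: dist_real_def\<close>)
  then obtain r where "0 < r" "r < s" "\<phi> s - \<phi> 0 = s * \<phi>' r"
    by auto
  moreover have "\<phi>' r < 0"
    using e1(2)[of r] \<open>\<phi>' 0 = 0\<close> calculation s by simp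
  ultimately have "\<phi> s < \<phi> 0"
    using s mult_pos_neg[of s "\<phi>' r"] by simp
  then show False
    using e2(2)[of s] s by (auto simp: dist_real_def)
qed

lemma eventually_line_in_open:
  fixes x h :: "'a::real_normed_vector"
  assumes "open S" "x \<in> S"
  shows "\<forall>\<^sub>F s in nhds 0. x + s *\<^sub>R h \<in> S"
proof -
  have "((\<lambda>s. x + s *\<^sub>R h) \<longlongrightarrow> x + 0 *\<^sub>R h) (nhds 0)"
    by (intro tendsto_intros filterlim_ident)
  then show ?thesis
    using topological_tendstoD[of _ x, OF _ assms] by simp
qed

lemma GDERIV_line:
  assumes "GDERIV u (x + s *\<^sub>R h) :> g"
  shows "((\<lambda>s. u (x + s *\<^sub>R h)) has_real_derivative g \<bullet> h) (at s)"
proof -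
  have "((\<lambda>s. u (x + s *\<^sub>R h)) has_derivative (\<lambda>r. (r *\<^sub>R h) \<bullet> g)) (at s)"
    by (rule has_derivative_compose[of "\<lambda>s. x + s *\<^sub>R h", OF _ assms[unfolded gderiv_def]])
      (auto intro!: derivative_eq_intros)
  then show ?thesis
    by (rule has_derivative_imp_has_field_derivative) (simp add: inner_commute)
qed

lemma jacobian_line:
  fixes g :: "real^'m \<Rightarrow> real^'m"
  assumes "g differentiable (at x)"
  shows "((\<lambda>s. g (x + s *\<^sub>R h) \<bullet> h) has_real_derivative h \<bullet> (jacobian g (at x) *v h)) (at 0)"
proof -
  have "(g has_derivative (\<lambda>h. jacobian g (at x) *v h)) (at (x + 0 *\<^sub>R h))"
    using assms jacobian_works by auto
  then have "((\<lambda>s. g (x + s *\<^sub>R h)) has_derivative (\<lambda>r. jacobian g (at x) *v (r *\<^sub>R h))) (at 0)"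
    by (rule has_derivative_compose[of "\<lambda>s. x + s *\<^sub>R h", rotated])
      (auto intro!: derivative_eq_intros)
  from has_derivative_inner_left[OF this, of h] show ?thesis
    by (rule has_derivative_imp_has_field_derivative)
      (simp add: matrix_vector_mult_scaleR inner_commute)
qed

text \<open>Two levels of \<open>Ck_on\<close> make every directional derivative of \<open>u\<close>
  differentiable, and these are the components of \<open>Du\<close>.\<close>

lemma smooth_imp_gradient_differentiable:
  fixes u :: "real^'m \<Rightarrow> real"
  assumes "open S" "smooth_on S u" "\<And>x. x \<in> S \<Longrightarrow> GDERIV u x :> Du x" "x \<in> S"
  shows "Du differentiable (at x)"
proof -
  have "Ck_on (Suc (Suc 0)) S u"
    using assms(2) by (auto simp only: smooth_on_def)
  then have d: "(\<lambda>y. frechet_derivative u (at y) v) differentiable (at x)" for v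
    using assms(4) by simp
  have eq: "frechet_derivative u (at y) v = Du y \<bullet> v" if "y \<in> S" for y v
    using frechet_derivative_at[OF assms(3)[OF that, unfolded gderiv_def], symmetric]
    by (simp add: inner_commute)
  have "(\<lambda>y. Du y \<bullet> v) differentiable (at x)" for v
  proof -
    obtain D where "((\<lambda>y. frechet_derivative u (at y) v) has_derivative D) (at x)"
      using d unfolding differentiable_def by blast
    then have "((\<lambda>y. Du y \<bullet> v) has_derivative D) (at x)"
      by (rule has_derivative_transform_within_open[OF _ assms(1,4)]) (simp add: eq)
    then show ?thesis by (rule differentiableI)
  qed
  then show ?thesis
    by (subst differentiable_componentwise_within) simp
qed

text \<open>This frees the condition on \<open>Gamma_plus\<close> from the choice of a frame: the
  level sets are strictly convex, the minus sign in \<open>level_set_endo\<close> turning positive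
  into negative.\<close>

lemma satisfies_equation_imp_hessian_neg:
  fixes f :: "real^'m \<Rightarrow> real^'n^'n \<Rightarrow> real"
  assumes "CARD('m) = CARD('n) + 1"
    and eq: "satisfies_equation f \<alpha> Du D" and x: "x \<in> D" "Du x \<noteq> 0"
    and h: "h \<noteq> 0" "Du x \<bullet> h = 0"
  shows "h \<bullet> (jacobian Du (at x) *v h) < 0"
proof -
  obtain e :: "'n \<Rightarrow> real^'m" where e: "onb_of_perp (Du x) e"
    using onb_of_perp_exists assms(1) x(2) by blast
  obtain v where v: "h = frame_comb e v"
    using frame_comb_surj[OF e h(2)] .
  then have "v \<noteq> 0"
    using h(1) linear_0[OF linear_frame_comb] by auto
  moreover have "component_matrix e (level_set_endo (Du x) (jacobian Du (at x))) \<in> Gamma_plus"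
    using eq x(1) e by (auto simp: satisfies_equation_def Let_def)
  ultimately have "0 < v \<bullet> (component_matrix e (level_set_endo (Du x) (jacobian Du (at x))) *v v)"
    by (auto simp: Gamma_plus_def)
  then show ?thesis
    using x(2) by (simp add: inner_shape_matrix[OF e] v divide_less_0_iff)
qed

section \<open>Solutions with a single critical point\<close>

text \<open>The common setting of (a), of (b) and of the superlevel sets in (b). Smoothness away
  from \<open>p\<close> enters as differentiability of \<open>Du\<close>.\<close>

locale speed_solution =
  fixes f :: "real^'m \<Rightarrow> real^'n^'n \<Rightarrow> real" and \<alpha> :: real
    and \<Omega> :: "(real^'m) set" and u :: "real^'m \<Rightarrow> real"
    and Du :: "real^'m \<Rightarrow> real^'m" and p :: "real^'m"
  assumes dim: "CARD('m) = CARD('n) + 1"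
    and alpha_pos: "0 < \<alpha>"
    and speed: "positive_speed f" "monotone_second f" "inverse_concave f"
    and open_dom: "open \<Omega>"
    and p_in: "p \<in> \<Omega>"
    and grad: "x \<in> \<Omega> \<Longrightarrow> GDERIV u x :> Du x"
    and crit: "x \<in> \<Omega> \<Longrightarrow> Du x = 0 \<longleftrightarrow> x = p"
    and grad_diff: "x \<in> \<Omega> \<Longrightarrow> x \<noteq> p \<Longrightarrow> Du differentiable (at x)"
    and equation: "satisfies_equation f \<alpha> Du (\<Omega> - {p})"
begin

lemma line_deriv: "x + s *\<^sub>R h \<in> \<Omega> \<Longrightarrow>
    ((\<lambda>s. u (x + s *\<^sub>R h)) has_real_derivative Du (x + s *\<^sub>R h) \<bullet> h) (at s)"
  by (intro GDERIV_line grad)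

text \<open>At such a minimum \<open>h\<close> would be tangent to the level set, and there the
  Hessian is negative definite.\<close>

lemma no_local_min_on_line:
  assumes x: "x \<in> \<Omega>" "x \<noteq> p" and h: "h \<noteq> 0"
  shows "\<not> (\<forall>\<^sub>F s in nhds 0. u x \<le> u (x + s *\<^sub>R h))"
proof
  assume min: "\<forall>\<^sub>F s in nhds 0. u x \<le> u (x + s *\<^sub>R h)"
  then obtain e where "e > 0" "\<And>s. dist s 0 < e \<Longrightarrow> u x \<le> u (x + s *\<^sub>R h)"
    unfolding eventually_nhds_metric by auto
  then have "Du x \<bullet> h = 0"
    by (intro DERIV_local_min[of "\<lambda>s. u (x + s *\<^sub>R h)" _ 0 e])
      (use line_deriv[of x 0 h] x in \<open>auto simp: dist_real_def\<close>)
  then have "h \<bullet> (jacobian Du (at x) *v h) < 0"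
    using satisfies_equation_imp_hessian_neg[OF dim equation, of x h] x h crit by auto
  moreover have "0 \<le> h \<bullet> (jacobian Du (at x) *v h)"
  proof (rule second_derivative_nonneg_at_local_min)
    show "\<forall>\<^sub>F s in nhds 0. ((\<lambda>s. u (x + s *\<^sub>R h)) has_real_derivative Du (x + s *\<^sub>R h) \<bullet> h) (at s)"
      using eventually_line_in_open[OF open_dom x(1)] by eventually_elim (rule line_deriv)
    show "((\<lambda>s. Du (x + s *\<^sub>R h) \<bullet> h) has_real_derivative h \<bullet> (jacobian Du (at x) *v h)) (at 0)"
      using jacobian_line grad_diff x by blast
  qed (use min in simp)
  ultimately show False by simp
qed

lemma local_extremum_critical:
  assumes "open S" "S \<subseteq> \<Omega>" "q \<in> S"
    and "(\<forall>y\<in>S. u y \<le> u q) \<or> (\<forall>y\<in>S. u q \<le> u y)"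
  shows "q = p"
proof -
  have "(u has_derivative (\<lambda>h. h \<bullet> Du q)) (at q)"
    using grad assms by (auto simp: gderiv_def)
  then have "(\<lambda>h. h \<bullet> Du q) = (\<lambda>h. 0)"
    using differential_zero_maxmin[OF assms(3,1)] assms(4) by blast
  then have "Du q \<bullet> Du q = 0" by meson
  then show ?thesis using crit assms by auto
qed

lemma other_point:
  assumes "open S" "x \<in> S"
  shows "\<exists>y\<in>S. y \<noteq> (x :: real^'m)"
proof (rule ccontr)
  assume "\<not> ?thesis"
  then have "S = {x}" using assms(2) by blast
  then show False using assms(1) by (simp add: not_open_singleton)
qed

lemma cont_u: "continuous_on \<Omega> u"
  using grad by (auto simp: gderiv_def intro!: continuous_at_imp_continuous_on has_derivative_continuous)

end

text \<open>The setting of (a). The boundary value is a parameter so that a superlevel set of a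
  solution in (b) is also an instance; \<open>bdry_grad\<close> extends \<open>crit\<close> to the
  boundary.\<close>

locale bounded_speed_solution = speed_solution f \<alpha> \<Omega> u Du p
  for f :: "real^'m \<Rightarrow> real^'n^'n \<Rightarrow> real" and \<alpha> \<Omega> u Du p +
  fixes c :: real
  assumes bdd: "bounded \<Omega>" and conv: "convex \<Omega>"
    and cont: "continuous_on (closure \<Omega>) u"
    and cont_grad: "continuous_on (closure \<Omega>) Du"
    and bdry: "x \<in> frontier \<Omega> \<Longrightarrow> u x = c"
    and bdry_grad: "x \<in> frontier \<Omega> \<Longrightarrow> Du x \<noteq> 0"
begin

lemma closure_cases: "x \<in> closure \<Omega> \<Longrightarrow> x \<in> \<Omega> \<or> x \<in> frontier \<Omega>"
  using open_dom by (simp add: frontier_def interior_open)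

lemma frontier_in_closure: "x \<in> frontier \<Omega> \<Longrightarrow> x \<in> closure \<Omega>"
  by (simp add: frontier_def)

lemma compact_closure: "compact (closure \<Omega>)"
  using bdd by (simp add: compact_closure)

lemma mem_closure: "x \<in> \<Omega> \<Longrightarrow> x \<in> closure \<Omega>"
  using closure_subset by blast

text \<open>A value below \<open>c\<close> is also taken at some \<open>y\<close> other than
  \<open>p\<close>. Minimising \<open>u\<close> over a hyperplane section through \<open>y\<close>
  that misses \<open>p\<close> gives an interior minimum, which is then a local minimum along a
  line.\<close>

lemma ge_boundary_value:
  assumes "y \<in> closure \<Omega>"
  shows "c \<le> u y"
proof (rule ccontr)
  assume "\<not> c \<le> u y"
  then have y: "y \<in> \<Omega>" "u y < c"
    using closure_cases[OF assms] bdry by auto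
  define S where "S = \<Omega> \<inter> u -` {..<c}"
  have "open S"
    unfolding S_def using continuous_open_preimage[OF cont_u open_dom open_lessThan] .
  moreover have "y \<in> S" using y by (simp add: S_def)
  ultimately obtain y' where "y' \<in> S" "y' \<noteq> y"
    using other_point by blast
  with \<open>y \<in> S\<close> obtain y where "y \<in> S" "y \<noteq> p"
    by metis
  then have y: "y \<in> \<Omega>" "u y < c" "y \<noteq> p"
    by (simp_all add: S_def)
  \<comment> \<open>Orthogonality to \<open>y - p\<close> is what keeps \<open>p\<close> off this
    hyperplane through \<open>y\<close>.\<close>
  define H where "H = {z. (y - p) \<bullet> (z - y) = 0}"
  have "closed H"
    unfolding H_def by (intro closed_Collect_eq continuous_intros)
  then have "compact (closure \<Omega> \<inter> H)"
    using compact_closure by (simp add: compact_Int_closed)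
  moreover have yH: "y \<in> closure \<Omega> \<inter> H"
    using y mem_closure by (simp add: H_def)
  ultimately obtain z where z: "z \<in> closure \<Omega>" "z \<in> H" "\<And>x. x \<in> closure \<Omega> \<Longrightarrow> x \<in> H \<Longrightarrow> u z \<le> u x"
    using continuous_attains_inf[of "closure \<Omega> \<inter> H" u] continuous_on_subset[OF cont] by blast
  have "u z < c"
    using z(3)[of y] yH y by simp
  then have zin: "z \<in> \<Omega>"
    using closure_cases[OF z(1)] bdry by auto
  have "p \<notin> H"
    using y(3) inner_gt_zero_iff[of "y - p"] by (simp add: H_def inner_diff_right inner_diff_left)
  then have "z \<noteq> p"
    using z(2) by auto
  \<comment> \<open>In dimension at least two the hyperplane contains a line through
    \<open>z\<close>.\<close>
  have "2 \<le> DIM(real^'m)"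
    using dim by simp
  then obtain h where h: "h \<noteq> 0" "orthogonal (y - p) h"
    using orthogonal_to_vector_exists by blast
  have "\<forall>\<^sub>F s in nhds 0. u z \<le> u (z + s *\<^sub>R h)"
    using eventually_line_in_open[OF open_dom zin, of h]
  proof eventually_elim
    case (elim s)
    have "z + s *\<^sub>R h \<in> H"
      using z(2) h(2) by (simp add: H_def orthogonal_def algebra_simps)
    with elim show ?case
      using z(3) mem_closure by blast
  qed
  with no_local_min_on_line[OF zin \<open>z \<noteq> p\<close> h(1)] show False by contradiction
qed

text \<open>An interior point with value \<open>c\<close> is a global minimum, hence
  \<open>p\<close>. The maximum is attained at \<open>p\<close> or on the boundary, so it is no
  larger than \<open>u p\<close>; then \<open>u\<close> is constant and every other point is
  critical as well.\<close>

lemma gt_boundary_value: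
  assumes "x \<in> \<Omega>"
  shows "c < u x"
proof (rule ccontr)
  assume "\<not> c < u x"
  then have le: "u x \<le> u y" if "y \<in> closure \<Omega>" for y
    using ge_boundary_value[OF that] by simp
  then have "x = p"
    using local_extremum_critical[OF open_dom order_refl assms] mem_closure by blast
  obtain q where q: "q \<in> closure \<Omega>" "\<And>y. y \<in> closure \<Omega> \<Longrightarrow> u y \<le> u q"
    using continuous_attains_sup[OF compact_closure _ cont] p_in mem_closure by blast
  have "u q \<le> u p"
  proof (cases "q \<in> \<Omega>")
    case True
    then have "q = p"
      using local_extremum_critical[OF open_dom order_refl True] q(2) mem_closure by blast
    then show ?thesis by simp
  next
    case False
    then have "u q = c" using closure_cases[OF q(1)] bdry by auto
    then show ?thesis
      using ge_boundary_value[OF mem_closure[OF p_in]] by simp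
  qed
  obtain y where y: "y \<in> \<Omega>" "y \<noteq> p"
    using other_point[OF open_dom p_in] by blast
  have "u z \<le> u y" if "z \<in> \<Omega>" for z
    using q(2)[of z] le[of y] \<open>u q \<le> u p\<close> \<open>x = p\<close> that y(1) mem_closure by force
  then have "y = p"
    using local_extremum_critical[OF open_dom order_refl y(1)] by blast
  with y show False by simp
qed

section \<open>Behaviour of the solution along segments from the boundary\<close>

lemma segment_to_interior:
  assumes "x \<in> closure \<Omega>" "z \<in> \<Omega>" "0 < s" "s \<le> 1"
  shows "x + s *\<^sub>R (z - x) \<in> \<Omega>"
proof -
  have "x - s *\<^sub>R (x - z) \<in> interior \<Omega>"
    using mem_interior_closure_convex_shrink[OF conv _ assms(1,3,4)] assms(2) open_dom
    by (simp add: interior_open)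
  then show ?thesis
    using open_dom by (simp add: interior_open algebra_simps)
qed

lemma segment_in_closure:
  assumes "x \<in> closure \<Omega>" "z \<in> \<Omega>" "0 \<le> s" "s \<le> 1"
  shows "x + s *\<^sub>R (z - x) \<in> closure \<Omega>"
  using segment_to_interior[of x z s] assms mem_closure by (cases "s = 0") auto

text \<open>The endpoint \<open>x\<close> may lie on the boundary, where \<open>u\<close> is only
  continuous; this is enough for the mean value theorem.\<close>

lemma segment_mvt:
  assumes x: "x \<in> closure \<Omega>" and z: "z \<in> \<Omega>" and s: "0 < s" "s \<le> 1"
  obtains r where "0 < r" "r < s" "u (x + s *\<^sub>R (z - x)) - u x = s * (Du (x + r *\<^sub>R (z - x)) \<bullet> (z - x))"
proof -
  define \<phi> where "\<phi> r = u (x + r *\<^sub>R (z - x))" for r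
  have der: "(\<phi> has_real_derivative Du (x + r *\<^sub>R (z - x)) \<bullet> (z - x)) (at r)" if "0 < r" "r < s" for r
    unfolding \<phi>_def using line_deriv segment_to_interior[OF x z] that s by simp
  have "continuous_on {0..s} \<phi>"
    unfolding \<phi>_def
    by (rule continuous_on_compose2[OF cont]) (auto intro!: continuous_intros segment_in_closure x z s order.trans[OF _ s(2)])
  then obtain l r where r: "0 < r" "r < s" "(\<phi> has_real_derivative l) (at r)" "\<phi> s - \<phi> 0 = (s - 0) * l"
    using MVT[OF s(1), of \<phi>] der by (metis real_differentiable_def)
  then have "l = Du (x + r *\<^sub>R (z - x)) \<bullet> (z - x)"
    using der DERIV_unique by blast
  then show ?thesis
    using that r by (simp add: \<phi>_def)
qed

lemma segment_grad_near:
  assumes x: "x \<in> closure \<Omega>" and z: "z \<in> \<Omega>" and e: "0 < e"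
  obtains d where "0 < d" "d \<le> 1"
    "\<And>r. 0 \<le> r \<Longrightarrow> r < d \<Longrightarrow> \<bar>Du (x + r *\<^sub>R (z - x)) \<bullet> (z - x) - Du x \<bullet> (z - x)\<bar> < e"
proof -
  have "continuous_on {0..1} (\<lambda>r. Du (x + r *\<^sub>R (z - x)) \<bullet> (z - x))"
    by (intro continuous_intros continuous_on_compose2[OF cont_grad]) (auto intro!: segment_in_closure x z)
  then obtain d where d: "0 < d" "\<And>r. r \<in> {0..1} \<Longrightarrow> dist r 0 < d \<Longrightarrow>
      dist (Du (x + r *\<^sub>R (z - x)) \<bullet> (z - x)) (Du (x + 0 *\<^sub>R (z - x)) \<bullet> (z - x)) < e"
    using e unfolding continuous_on_iff by (metis atLeastAtMost_iff zero_le_one order_refl)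
  show ?thesis
    by (rule that[of "min d 1"]) (use d in \<open>auto simp: dist_real_def\<close>)
qed

text \<open>The slope is non-negative because \<open>u\<close> stays at or above \<open>c\<close> on
  the segment. If it vanished, moving \<open>z\<close> slightly in the direction
  \<open>- Du x\<close> within the open domain would make it negative.\<close>

lemma boundary_slope_pos:
  assumes x: "x \<in> frontier \<Omega>" and z: "z \<in> \<Omega>"
  shows "0 < Du x \<bullet> (z - x)"
proof -
  note xc = frontier_in_closure[OF x]
  have nonneg: "0 \<le> Du x \<bullet> (z - x)" if z: "z \<in> \<Omega>" for z
  proof (rule ccontr)
    assume neg: "\<not> 0 \<le> Du x \<bullet> (z - x)"
    then obtain d where d: "0 < d" "d \<le> 1" "\<And>r. 0 \<le> r \<Longrightarrow> r < d \<Longrightarrow>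
        \<bar>Du (x + r *\<^sub>R (z - x)) \<bullet> (z - x) - Du x \<bullet> (z - x)\<bar> < - (Du x \<bullet> (z - x))"
      using segment_grad_near[OF xc z, of "- (Du x \<bullet> (z - x))"] by auto
    obtain r where r: "0 < r" "r < d"
        "u (x + d *\<^sub>R (z - x)) - u x = d * (Du (x + r *\<^sub>R (z - x)) \<bullet> (z - x))"
      using segment_mvt[OF xc z d(1,2)] .
    have "Du (x + r *\<^sub>R (z - x)) \<bullet> (z - x) < 0"
      using d(3)[of r] r neg by linarith
    then have "u (x + d *\<^sub>R (z - x)) < u x"
      using r(3) mult_pos_neg[OF d(1)] by force
    moreover have "c \<le> u (x + d *\<^sub>R (z - x))"
      using ge_boundary_value segment_in_closure[OF xc z] d by simp
    ultimately show False
      using bdry[OF x] by simp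
  qed
  show ?thesis
  proof (rule ccontr)
    assume "\<not> ?thesis"
    with nonneg[OF z] have zero: "Du x \<bullet> (z - x) = 0" by simp
    have "\<forall>\<^sub>F s in nhds 0. z + s *\<^sub>R Du x \<in> \<Omega>"
      by (rule eventually_line_in_open[OF open_dom z])
    then obtain e where e: "0 < e" "\<And>s. dist s 0 < e \<Longrightarrow> z + s *\<^sub>R Du x \<in> \<Omega>"
      unfolding eventually_nhds_metric by auto
    from e(2)[of "- e / 2"] e(1) have "z + (- e / 2) *\<^sub>R Du x \<in> \<Omega>"
      by (simp add: dist_real_def)
    from nonneg[OF this] have "0 \<le> Du x \<bullet> (z - x) - e / 2 * (Du x \<bullet> Du x)"
      by (simp add: algebra_simps)
    then have "Du x \<bullet> Du x \<le> 0"
      using zero e(1) by (simp add: mult_le_0_iff)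
    then show False
      using bdry_grad[OF x] inner_gt_zero_iff[of "Du x"] by linarith
  qed
qed

end

section \<open>Concavity on a bounded domain\<close>

context bounded_speed_solution
begin

definition expo :: real where
  "expo = 1 / (1 + \<alpha>)"

definition W :: "real^'m \<Rightarrow> real" where
  "W x = ((1 + \<alpha>) * (u x - c)) powr expo"

text \<open>The chain-rule factor in \<open>DW = slope * Du\<close>; the constant
  \<open>1 + \<alpha>\<close> cancels against the exponent \<open>expo\<close>.\<close>

definition slope :: "real^'m \<Rightarrow> real" where
  "slope x = ((1 + \<alpha>) * (u x - c)) powr (expo - 1)"

lemma expo: "0 < expo" "expo < 1" "expo * (1 + \<alpha>) = 1"
  using alpha_pos by (auto simp: expo_def)

lemma W_frontier: "x \<in> frontier \<Omega> \<Longrightarrow> W x = 0"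
  by (simp add: W_def bdry)

lemma base_pos: "x \<in> \<Omega> \<Longrightarrow> 0 < (1 + \<alpha>) * (u x - c)"
  using gt_boundary_value alpha_pos by simp

lemma W_nonneg: "0 \<le> W x"
  by (simp add: W_def)

lemma slope_pos: "x \<in> \<Omega> \<Longrightarrow> 0 < slope x"
  using gt_boundary_value[of x] alpha_pos by (simp add: slope_def)

lemma W_pos: "x \<in> \<Omega> \<Longrightarrow> 0 < W x"
  using gt_boundary_value[of x] alpha_pos by (simp add: W_def)

lemma W_line:
  assumes "x + s *\<^sub>R h \<in> \<Omega>"
  shows "((\<lambda>s. W (x + s *\<^sub>R h)) has_real_derivative
           slope (x + s *\<^sub>R h) * (Du (x + s *\<^sub>R h) \<bullet> h)) (at s)"
proof -
  have "((\<lambda>s. (1 + \<alpha>) * (u (x + s *\<^sub>R h) - c)) has_real_derivative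
      (1 + \<alpha>) * (Du (x + s *\<^sub>R h) \<bullet> h)) (at s)"
    by (rule DERIV_cong[OF DERIV_cmult[OF DERIV_diff[OF line_deriv[OF assms] DERIV_const]]]) simp
  from DERIV_chain2[OF has_real_derivative_powr[OF base_pos[OF assms]] this]
  have "((\<lambda>s. W (x + s *\<^sub>R h)) has_real_derivative
      expo * slope (x + s *\<^sub>R h) * ((1 + \<alpha>) * (Du (x + s *\<^sub>R h) \<bullet> h))) (at s)"
    by (simp add: W_def slope_def)
  also have "expo * slope (x + s *\<^sub>R h) * ((1 + \<alpha>) * (Du (x + s *\<^sub>R h) \<bullet> h))
      = (expo * (1 + \<alpha>)) * (slope (x + s *\<^sub>R h) * (Du (x + s *\<^sub>R h) \<bullet> h))"
    by (simp only: mult_ac)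
  finally show ?thesis
    by (simp add: expo(3))
qed

text \<open>In a direction tangent to the level set the derivative of \<open>slope\<close> vanishes,
  so only the Hessian of \<open>u\<close> survives.\<close>

lemma W_line_second:
  assumes x: "x \<in> \<Omega>" "x \<noteq> p" and h: "Du x \<bullet> h = 0"
  shows "((\<lambda>s. slope (x + s *\<^sub>R h) * (Du (x + s *\<^sub>R h) \<bullet> h)) has_real_derivative
           slope x * (h \<bullet> (jacobian Du (at x) *v h))) (at 0)"
proof -
  have x0: "x + 0 *\<^sub>R h \<in> \<Omega>" using x by simp
  have "((\<lambda>s. (1 + \<alpha>) * (u (x + s *\<^sub>R h) - c)) has_real_derivative
      (1 + \<alpha>) * (Du (x + 0 *\<^sub>R h) \<bullet> h)) (at 0)"
    by (rule DERIV_cong[OF DERIV_cmult[OF DERIV_diff[OF line_deriv[OF x0] DERIV_const]]]) simp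
  from DERIV_chain2[OF has_real_derivative_powr[OF base_pos[OF x0]] this]
  have "((\<lambda>s. slope (x + s *\<^sub>R h)) has_real_derivative 0) (at 0)"
    by (simp add: slope_def h)
  from DERIV_mult[OF this jacobian_line[OF grad_diff[OF x], of h]] show ?thesis
    by (simp add: mult_ac)
qed

text \<open>
  The exponent of \<open>W\<close> is less than \<open>1\<close>, so \<open>W\<close> leaves the boundary with infinite slope, while it
  is differentiable at \<open>z\<close>.
\<close>

lemma steep_at_boundary:
  assumes x: "x \<in> frontier \<Omega>" and z: "z \<in> \<Omega>" and a: "0 < a"
  shows "\<not> (\<forall>\<^sub>F s in at_right 0.
           a * W (x + s *\<^sub>R (z - x)) \<le> W (z + s *\<^sub>R b) - W z)"
proof
  assume le: "\<forall>\<^sub>F s in at_right 0. a * W (x + s *\<^sub>R (z - x)) \<le> W (z + s *\<^sub>R b) - W z"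
  note xc = frontier_in_closure[OF x]
  define \<kappa> where "\<kappa> = Du x \<bullet> (z - x) / 2"
  have \<kappa>: "0 < \<kappa>"
    using boundary_slope_pos[OF x z] by (simp add: \<kappa>_def)
  \<comment> \<open>Half of the boundary slope persists near \<open>x\<close>; \<open>K\<close> is
    the resulting constant in the lower bound of \<open>W\<close> by
    \<open>K * s powr expo\<close>.\<close>
  define K where "K = ((1 + \<alpha>) * \<kappa>) powr expo"
  have K: "0 < K"
    using \<kappa> alpha_pos by (simp add: K_def)
  obtain d where d: "0 < d" "d \<le> 1"
    "\<And>r. 0 \<le> r \<Longrightarrow> r < d \<Longrightarrow> \<bar>Du (x + r *\<^sub>R (z - x)) \<bullet> (z - x) - Du x \<bullet> (z - x)\<bar> < \<kappa>"
    using segment_grad_near[OF xc z \<kappa>] by blast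
  have W_lower: "K * s powr expo \<le> W (x + s *\<^sub>R (z - x))" if s: "0 < s" "s < d" for s
  proof -
    obtain r where r: "0 < r" "r < s"
        "u (x + s *\<^sub>R (z - x)) - u x = s * (Du (x + r *\<^sub>R (z - x)) \<bullet> (z - x))"
      using segment_mvt[OF xc z s(1)] s d(2) by auto
    have "\<kappa> \<le> Du (x + r *\<^sub>R (z - x)) \<bullet> (z - x)"
      using d(3)[of r] r s unfolding \<kappa>_def by (auto simp: abs_if split: if_splits)
    then have "s * \<kappa> \<le> u (x + s *\<^sub>R (z - x)) - c"
      using r(3) s bdry[OF x] by simp
    then have "(1 + \<alpha>) * (s * \<kappa>) \<le> (1 + \<alpha>) * (u (x + s *\<^sub>R (z - x)) - c)"
      using alpha_pos by (intro mult_left_mono) auto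
    then have "((1 + \<alpha>) * (s * \<kappa>)) powr expo \<le> W (x + s *\<^sub>R (z - x))"
      unfolding W_def using s \<kappa> alpha_pos expo(1) by (intro powr_mono2) auto
    moreover have "((1 + \<alpha>) * (s * \<kappa>)) powr expo = K * s powr expo"
      using s \<kappa> alpha_pos by (simp add: K_def powr_mult[symmetric] mult_ac)
    ultimately show ?thesis by simp
  qed
  define D where "D = slope z * (Du z \<bullet> b)"
  have "((\<lambda>s. W (z + s *\<^sub>R b)) has_real_derivative D) (at 0)"
    using W_line[of z 0 b] z by (simp add: D_def)
  then have "((\<lambda>s. (W (z + s *\<^sub>R b) - W z) / s) \<longlongrightarrow> D) (at 0)"
    by (simp add: DERIV_def)
  then have "((\<lambda>s. (W (z + s *\<^sub>R b) - W z) / s) \<longlongrightarrow> D) (at_right 0)"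
    by (rule filterlim_mono[OF _ order_refl]) (simp add: at_le)
  moreover have "((\<lambda>s::real. s powr (1 - expo)) \<longlongrightarrow> 0) (at_right 0)"
    using expo(2) by (intro tendsto_zero_powrI[where b = "1 - expo"])
      (auto intro!: tendsto_intros eventually_at_rightI[of 0 1])
  \<comment> \<open>Dividing the assumed inequality by \<open>s powr expo\<close> bounds this
    product below by the positive number \<open>a * K\<close>, although its limit is 0.\<close>
  ultimately have lim: "((\<lambda>s. (W (z + s *\<^sub>R b) - W z) / s * s powr (1 - expo)) \<longlongrightarrow> D * 0) (at_right 0)"
    by (rule tendsto_mult)
  have "\<forall>\<^sub>F s in at_right 0. 0 < s \<and> s < d"
    using eventually_at_rightI[of 0 d "\<lambda>s. 0 < s \<and> s < d"] d(1) by auto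
  with le have "\<forall>\<^sub>F s in at_right 0. a * K \<le> (W (z + s *\<^sub>R b) - W z) / s * s powr (1 - expo)"
  proof eventually_elim
    case (elim s)
    have "a * (K * s powr expo) \<le> a * W (x + s *\<^sub>R (z - x))"
      using W_lower elim a by (intro mult_left_mono) auto
    then have "a * K * s powr expo \<le> W (z + s *\<^sub>R b) - W z"
      using elim by simp
    then have "a * K * s powr expo * s powr (- expo) \<le> (W (z + s *\<^sub>R b) - W z) * s powr (- expo)"
      by (rule mult_right_mono) simp
    also have "a * K * s powr expo * s powr (- expo) = a * K"
      using elim by (simp add: powr_minus)
    also have "s powr (- expo) = s powr (1 - expo) / s"
      using elim by (simp add: powr_diff powr_minus divide_simps)
    finally show ?case by simp
  qed
  from tendsto_lowerbound[OF lim this] have "a * K \<le> 0"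
    by simp
  then show False
    using a K by (simp add: mult_le_0_iff)
qed

text \<open>This is the equation rewritten for \<open>W\<close>, whose gradient is \<open>\<xi>\<close>.\<close>

lemma inverse_speed:
  assumes x: "x \<in> \<Omega>" "x \<noteq> p" and \<xi>: "\<xi> = slope x *\<^sub>R Du x" and e: "onb_of_perp \<xi> e"
  defines "r \<equiv> component_matrix e (level_set_endo (Du x) (jacobian Du (at x)))"
  shows "r \<in> Gamma_plus"
    and "1 / f (- (\<xi> /\<^sub>R norm \<xi>)) r = norm \<xi> powr (1 / \<alpha>) * W x"
    and "norm \<xi> * (v \<bullet> (r *v v)) =
      - (slope x * (frame_comb e v \<bullet> (jacobian Du (at x) *v frame_comb e v)))"
proof -
  have Du: "Du x \<noteq> 0" using crit x by simp
  note sp = slope_pos[OF x(1)]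
  have e': "onb_of_perp (Du x) e"
    using e onb_of_perp_scale[of "slope x" "Du x" e] sp by (simp add: \<xi>)
  have eq: "r \<in> Gamma_plus \<and> norm (Du x) * f (- (Du x /\<^sub>R norm (Du x))) r powr \<alpha> = 1"
    using equation x e' unfolding satisfies_equation_def Let_def r_def by blast
  then show r: "r \<in> Gamma_plus" by blast
  have n: "norm \<xi> = slope x * norm (Du x)"
    using sp by (simp add: \<xi>)
  have dir: "\<xi> /\<^sub>R norm \<xi> = Du x /\<^sub>R norm (Du x)"
    unfolding n using sp by (simp add: \<xi>)
  define \<phi> where "\<phi> = f (- (Du x /\<^sub>R norm (Du x))) r"
  have "- (Du x /\<^sub>R norm (Du x)) \<in> sphere 0 1"
    using Du by simp
  then have \<phi>: "0 < \<phi>"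
    using speed(1) r unfolding positive_speed_def \<phi>_def by blast
  have nphi: "norm \<xi> = slope x * \<phi> powr (- \<alpha>)"
  proof -
    have "norm (Du x) * \<phi> powr \<alpha> = 1"
      using eq by (simp add: \<phi>_def)
    then have "norm (Du x) = \<phi> powr (- \<alpha>)"
      using \<phi> by (simp add: powr_minus divide_simps)
    then show ?thesis by (simp add: n)
  qed
  have "norm \<xi> powr (1 / \<alpha>) = slope x powr (1 / \<alpha>) * \<phi> powr (- 1)"
    unfolding nphi using sp \<phi> alpha_pos by (simp add: powr_mult powr_powr)
  also have "slope x powr (1 / \<alpha>) = ((1 + \<alpha>) * (u x - c)) powr (- expo)"
  proof -
    \<comment> \<open>This identity singles out the exponent \<open>1 / (1 + \<alpha>)\<close>: it
      turns the power of \<open>slope\<close> into exactly the reciprocal of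
      \<open>W\<close>.\<close>
    have "(expo - 1) * (1 / \<alpha>) = - expo"
      using alpha_pos by (simp add: expo_def divide_simps)
    then show ?thesis by (simp add: slope_def powr_powr)
  qed
  also have "\<dots> = inverse (W x)"
    by (simp add: W_def powr_minus)
  finally have "norm \<xi> powr (1 / \<alpha>) * W x = \<phi> powr (- 1)"
    using W_pos[OF x(1)] by simp
  then show "1 / f (- (\<xi> /\<^sub>R norm \<xi>)) r = norm \<xi> powr (1 / \<alpha>) * W x"
    using \<phi> unfolding dir \<phi>_def[symmetric] by (simp add: powr_minus divide_simps)
  show "norm \<xi> * (v \<bullet> (r *v v)) =
      - (slope x * (frame_comb e v \<bullet> (jacobian Du (at x) *v frame_comb e v)))"
    unfolding r_def inner_shape_matrix[OF e'] n using Du by simp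
qed

text \<open>On the boundary the base is 0, where \<open>powr\<close> is still continuous because the
  exponent is positive.\<close>

lemma continuous_on_W: "continuous_on (closure \<Omega>) W"
  unfolding W_def
  by (rule continuous_on_powr')
    (use ge_boundary_value alpha_pos expo(1) in \<open>auto intro!: continuous_intros cont\<close>)

text \<open>
  The equation at an interior minimum of the two-point function: the three gradients are equal to
  \<open>\<xi>\<close>, and the second-order condition along \<open>\<xi>\<^sup>\<bottom>\<close> compares the second fundamental forms
  as in \<open>inverse_concave_harmonic\<close>.
\<close>

lemma W_at_interior_min:
  assumes t: "0 < t" "t < 1" and xy: "x \<in> \<Omega>" "y \<in> \<Omega>" and z: "z \<in> \<Omega>"
    and min: "\<And>h k. \<forall>\<^sub>F s in nhds 0.
      W z - (1 - t) * W x - t * W y \<le>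
      W (z + s *\<^sub>R ((1 - t) *\<^sub>R h + t *\<^sub>R k)) - (1 - t) * W (x + s *\<^sub>R h) - t * W (y + s *\<^sub>R k)"
    and zeq: "z = (1 - t) *\<^sub>R x + t *\<^sub>R y"
  shows "(1 - t) * W x + t * W y \<le> W z"
proof -
  \<comment> \<open>The points \<open>x\<close> and \<open>y\<close> move independently along
    \<open>h\<close> and \<open>k\<close>, which forces \<open>z\<close> to move along the weighted
    mean.\<close>
  define Z where "Z h k s = W (z + s *\<^sub>R ((1 - t) *\<^sub>R h + t *\<^sub>R k))
    - (1 - t) * W (x + s *\<^sub>R h) - t * W (y + s *\<^sub>R k)" for h k s
  define DW where "DW q = slope q *\<^sub>R Du q" for q
  define Z' where "Z' h k s = slope (z + s *\<^sub>R ((1 - t) *\<^sub>R h + t *\<^sub>R k)) *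
      (Du (z + s *\<^sub>R ((1 - t) *\<^sub>R h + t *\<^sub>R k)) \<bullet> ((1 - t) *\<^sub>R h + t *\<^sub>R k))
    - (1 - t) * (slope (x + s *\<^sub>R h) * (Du (x + s *\<^sub>R h) \<bullet> h))
    - t * (slope (y + s *\<^sub>R k) * (Du (y + s *\<^sub>R k) \<bullet> k))" for h k s
  have minZ: "\<forall>\<^sub>F s in nhds 0. Z h k 0 \<le> Z h k s" for h k
    using min[of h k] by (simp add: Z_def)
  have derZ: "\<forall>\<^sub>F s in nhds 0. (Z h k has_real_derivative Z' h k s) (at s)" for h k
    using eventually_line_in_open[OF open_dom xy(1), of h] eventually_line_in_open[OF open_dom xy(2), of k]
      eventually_line_in_open[OF open_dom z, of "(1 - t) *\<^sub>R h + t *\<^sub>R k"]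
  proof eventually_elim
    case (elim s)
    show ?case
      unfolding Z_def Z'_def
      by (intro DERIV_diff DERIV_cmult W_line elim)
  qed
  have first: "DW z \<bullet> ((1 - t) *\<^sub>R h + t *\<^sub>R k) = (1 - t) * (DW x \<bullet> h) + t * (DW y \<bullet> k)" for h k
  proof -
    obtain e where e: "e > 0" "\<And>s. dist s 0 < e \<Longrightarrow> Z h k 0 \<le> Z h k s"
      using minZ[of h k] unfolding eventually_nhds_metric by auto
    have "(Z h k has_real_derivative Z' h k 0) (at 0)"
      using derZ[of h k] by (rule eventually_nhds_x_imp_x)
    then have "Z' h k 0 = 0"
      by (rule DERIV_local_min[OF _ e(1)]) (use e(2) in \<open>auto simp: dist_real_def\<close>)
    then show ?thesis by (simp add: Z'_def DW_def)
  qed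
  define \<xi> where "\<xi> = DW z"
  \<comment> \<open>Varying only \<open>x\<close> (\<open>k = 0\<close>), and below only
    \<open>y\<close> (\<open>h = 0\<close>), separates the first-order condition.\<close>
  have xi_x: "\<xi> = DW x"
  proof -
    have "DW z \<bullet> h = DW x \<bullet> h" for h
      using first[of h 0] t by simp
    then show ?thesis by (metis vector_eq_rdot \<xi>_def)
  qed
  have xi_y: "\<xi> = DW y"
  proof -
    have "DW z \<bullet> k = DW y \<bullet> k" for k
      using first[of 0 k] t by simp
    then show ?thesis by (metis vector_eq_rdot \<xi>_def)
  qed
  have DW0: "DW q = 0 \<longleftrightarrow> q = p" if "q \<in> \<Omega>" for q
    using slope_pos[OF that] crit[OF that] by (simp add: DW_def)
  show ?thesis
  proof (cases "\<xi> = 0")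
    case True
    then have "x = p" "y = p" "z = p"
      using DW0[OF xy(1)] DW0[OF xy(2)] DW0[OF z] xi_x xi_y by (simp_all add: \<xi>_def)
    then show ?thesis by (simp add: algebra_simps)
  next
    case False
    then have np: "x \<noteq> p" "y \<noteq> p" "z \<noteq> p"
      using DW0[OF xy(1)] DW0[OF xy(2)] DW0[OF z] xi_x xi_y by (auto simp: \<xi>_def)
    define Q where "Q q h = slope q * (h \<bullet> (jacobian Du (at q) *v h))" for q h
    have perp: "Du q \<bullet> h = 0" if "q \<in> \<Omega>" "\<xi> = DW q" "\<xi> \<bullet> h = 0" for q h
      using that slope_pos[of q] by (simp add: DW_def)
    \<comment> \<open>Keeping \<open>h\<close> and \<open>k\<close> independent is what yields the
      harmonic rather than the arithmetic mean of the curvature forms.\<close>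
    have second: "(1 - t) * Q x h + t * Q y k \<le> Q z ((1 - t) *\<^sub>R h + t *\<^sub>R k)"
      if hk: "\<xi> \<bullet> h = 0" "\<xi> \<bullet> k = 0" for h k
    proof -
      have zk: "\<xi> \<bullet> ((1 - t) *\<^sub>R h + t *\<^sub>R k) = 0"
        using hk by (simp add: inner_add_right)
      have "(Z' h k has_real_derivative Q z ((1 - t) *\<^sub>R h + t *\<^sub>R k) - (1 - t) * Q x h - t * Q y k) (at 0)"
        unfolding Z'_def Q_def
        by (intro DERIV_diff DERIV_cmult W_line_second xy z np perp xi_x xi_y hk zk \<xi>_def)
      from second_derivative_nonneg_at_local_min[OF derZ this minZ] show ?thesis by simp
    qed
    obtain e :: "'n \<Rightarrow> real^'m" where e: "onb_of_perp \<xi> e"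
      using onb_of_perp_exists[OF dim False] by blast
    define r where "r q = component_matrix e (level_set_endo (Du q) (jacobian Du (at q)))" for q
    have xi_z: "\<xi> = DW z" by (simp add: \<xi>_def)
    note rx = inverse_speed[OF xy(1) np(1) xi_x[unfolded DW_def] e, folded r_def]
    note ry = inverse_speed[OF xy(2) np(2) xi_y[unfolded DW_def] e, folded r_def]
    note rz = inverse_speed[OF z np(3) xi_z[unfolded DW_def] e, folded r_def]
    have "(1 - t) / f (- (\<xi> /\<^sub>R norm \<xi>)) (r x) + t / f (- (\<xi> /\<^sub>R norm \<xi>)) (r y)
        \<le> 1 / f (- (\<xi> /\<^sub>R norm \<xi>)) (r z)"
    proof (rule inverse_concave_harmonic[OF speed _ rx(1) ry(1) rz(1) t])
      show "- (\<xi> /\<^sub>R norm \<xi>) \<in> sphere 0 1"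
        using False by simp
      fix a b :: "real^'n"
      let ?v = "(1 - t) *\<^sub>R a + t *\<^sub>R b"
      have comb: "frame_comb e ?v = (1 - t) *\<^sub>R frame_comb e a + t *\<^sub>R frame_comb e b"
        by (simp add: linear_add[OF linear_frame_comb] linear_scale[OF linear_frame_comb])
      \<comment> \<open>By \<open>inverse_speed\<close> the curvature form times the norm of \<xi>
        is minus \<open>Q\<close>, so the second-order inequality reverses.\<close>
      have "norm \<xi> * (?v \<bullet> (r z *v ?v)) = - Q z (frame_comb e ?v)"
        by (simp add: rz(3) Q_def)
      also have "\<dots> \<le> - ((1 - t) * Q x (frame_comb e a) + t * Q y (frame_comb e b))"
        unfolding comb using second[of "frame_comb e a" "frame_comb e b"]
        by (simp add: frame_comb_orthogonal[OF e])
      also have "\<dots> = (1 - t) * (norm \<xi> * (a \<bullet> (r x *v a))) + t * (norm \<xi> * (b \<bullet> (r y *v b)))"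
        by (simp add: rx(3) ry(3) Q_def)
      also have "\<dots> = norm \<xi> * ((1 - t) * (a \<bullet> (r x *v a)) + t * (b \<bullet> (r y *v b)))"
        by (simp only: distrib_left mult_ac)
      finally show "?v \<bullet> (r z *v ?v) \<le> (1 - t) * (a \<bullet> (r x *v a)) + t * (b \<bullet> (r y *v b))"
        using False by simp
    qed
    moreover have "(1 - t) / f (- (\<xi> /\<^sub>R norm \<xi>)) (r x) = (1 - t) * (norm \<xi> powr (1 / \<alpha>) * W x)"
      unfolding rx(2)[symmetric] by simp
    moreover have "t / f (- (\<xi> /\<^sub>R norm \<xi>)) (r y) = t * (norm \<xi> powr (1 / \<alpha>) * W y)"
      unfolding ry(2)[symmetric] by simp
    ultimately have "(1 - t) * (norm \<xi> powr (1 / \<alpha>) * W x) + t * (norm \<xi> powr (1 / \<alpha>) * W y)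
        \<le> norm \<xi> powr (1 / \<alpha>) * W z"
      by (simp only: rz(2))
    then have "norm \<xi> powr (1 / \<alpha>) * ((1 - t) * W x + t * W y) \<le> norm \<xi> powr (1 / \<alpha>) * W z"
      by (simp only: distrib_left mult_ac)
    then show ?thesis
      using False by simp
  qed
qed

text \<open>The two-point function attains its minimum on a compact product. If \<open>z\<close> is
  on the boundary, so are \<open>a\<close> and \<open>b\<close>, and \<open>W\<close> vanishes at
  both. Otherwise \<open>steep_at_boundary\<close> puts \<open>a\<close> and \<open>b\<close> in the
  interior, where \<open>W_at_interior_min\<close> applies.\<close>

lemma W_combination:
  assumes t: "0 < t" "t < 1" and xy: "x \<in> closure \<Omega>" "y \<in> closure \<Omega>"
  shows "(1 - t) * W x + t * W y \<le> W ((1 - t) *\<^sub>R x + t *\<^sub>R y)"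
proof -
  let ?C = "closure \<Omega>"
  have conv_mem: "(1 - t) *\<^sub>R a + t *\<^sub>R b \<in> ?C" if "a \<in> ?C" "b \<in> ?C" for a b
    using convexD_alt[OF convex_closure[OF conv] that] t by simp
  define Z where "Z q = W ((1 - t) *\<^sub>R fst q + t *\<^sub>R snd q) - (1 - t) * W (fst q) - t * W (snd q)" for q
  have "continuous_on (?C \<times> ?C) Z"
    unfolding Z_def
    by (intro continuous_intros continuous_on_compose2[OF continuous_on_W])
      (auto intro!: conv_mem)
  moreover have "compact (?C \<times> ?C)" "?C \<times> ?C \<noteq> {}"
    using compact_closure xy by (auto intro: compact_Times)
  ultimately obtain q where q: "q \<in> ?C \<times> ?C" "\<And>q'. q' \<in> ?C \<times> ?C \<Longrightarrow> Z q \<le> Z q'"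
    using continuous_attains_inf[of "?C \<times> ?C" Z] by blast
  obtain a b where ab: "q = (a, b)" "a \<in> ?C" "b \<in> ?C"
    using q(1) by auto
  define z where "z = (1 - t) *\<^sub>R a + t *\<^sub>R b"
  have zC: "z \<in> ?C" unfolding z_def by (rule conv_mem[OF ab(2,3)])
  have min: "W z - (1 - t) * W a - t * W b \<le>
      W ((1 - t) *\<^sub>R a' + t *\<^sub>R b') - (1 - t) * W a' - t * W b'" if "a' \<in> ?C" "b' \<in> ?C" for a' b'
    using q(2)[of "(a', b')"] that by (simp add: Z_def ab(1) z_def)
  have "0 \<le> W z - (1 - t) * W a - t * W b"
  proof (cases "z \<in> \<Omega>")
    case False
    have "a \<in> frontier \<Omega>"
    proof (rule ccontr)
      assume "a \<notin> frontier \<Omega>"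
      then have "a \<in> \<Omega>" using closure_cases[OF ab(2)] by blast
      from segment_to_interior[OF ab(3) this, of "1 - t"] t have "z \<in> \<Omega>"
        by (simp add: z_def algebra_simps)
      with False show False by simp
    qed
    moreover have "b \<in> frontier \<Omega>"
    proof (rule ccontr)
      assume "b \<notin> frontier \<Omega>"
      then have "b \<in> \<Omega>" using closure_cases[OF ab(3)] by blast
      from segment_to_interior[OF ab(2) this, of t] t have "z \<in> \<Omega>"
        by (simp add: z_def algebra_simps)
      with False show False by simp
    qed
    ultimately show ?thesis
      by (simp add: W_frontier W_nonneg)
  next
    case True
    note z = True
    have seg: "\<forall>\<^sub>F s in at_right 0. x + s *\<^sub>R (z - x) \<in> ?C" if "x \<in> ?C" for x
      by (rule eventually_at_rightI[of 0 1]) (auto intro: segment_in_closure[OF that z])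
    \<comment> \<open>If \<open>W a = 0\<close>, minimality under moving \<open>a\<close> alone
      towards \<open>z\<close> says that \<open>W\<close> near \<open>z\<close> grows at least like
      a multiple of \<open>W\<close> near \<open>a\<close>, against the infinite slope
      there.\<close>
    have a: "a \<in> \<Omega>"
    proof (rule ccontr)
      assume "a \<notin> \<Omega>"
      then have fr: "a \<in> frontier \<Omega>" using closure_cases[OF ab(2)] by blast
      have "\<forall>\<^sub>F s in at_right 0. (1 - t) * W (a + s *\<^sub>R (z - a)) \<le> W (z + s *\<^sub>R ((1 - t) *\<^sub>R (z - a))) - W z"
        using seg[OF ab(2)]
      proof eventually_elim
        case (elim s)
        have eq: "(1 - t) *\<^sub>R (a + s *\<^sub>R v) + t *\<^sub>R b = z + s *\<^sub>R ((1 - t) *\<^sub>R v)" for v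
          by (simp add: z_def algebra_simps)
        from min[OF elim ab(3)] show ?case
          unfolding eq using W_frontier[OF fr] by simp
      qed
      with steep_at_boundary[OF fr z, of "1 - t" "(1 - t) *\<^sub>R (z - a)"] t show False by simp
    qed
    have b: "b \<in> \<Omega>"
    proof (rule ccontr)
      assume "b \<notin> \<Omega>"
      then have fr: "b \<in> frontier \<Omega>" using closure_cases[OF ab(3)] by blast
      have "\<forall>\<^sub>F s in at_right 0. t * W (b + s *\<^sub>R (z - b)) \<le> W (z + s *\<^sub>R (t *\<^sub>R (z - b))) - W z"
        using seg[OF ab(3)]
      proof eventually_elim
        case (elim s)
        have eq: "(1 - t) *\<^sub>R a + t *\<^sub>R (b + s *\<^sub>R v) = z + s *\<^sub>R (t *\<^sub>R v)" for v
          by (simp add: z_def algebra_simps)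
        from min[OF ab(2) elim] show ?case
          unfolding eq using W_frontier[OF fr] by simp
      qed
      with steep_at_boundary[OF fr z, of t "t *\<^sub>R (z - b)"] t show False by simp
    qed
    have "(1 - t) * W a + t * W b \<le> W z"
    proof (rule W_at_interior_min[OF t a b z _ z_def])
      fix h k
      show "\<forall>\<^sub>F s in nhds 0. W z - (1 - t) * W a - t * W b \<le>
        W (z + s *\<^sub>R ((1 - t) *\<^sub>R h + t *\<^sub>R k)) - (1 - t) * W (a + s *\<^sub>R h) - t * W (b + s *\<^sub>R k)"
        using eventually_line_in_open[OF open_dom a, of h] eventually_line_in_open[OF open_dom b, of k]
      proof eventually_elim
        case (elim s)
        have eq: "(1 - t) *\<^sub>R (a + s *\<^sub>R h) + t *\<^sub>R (b + s *\<^sub>R k) = z + s *\<^sub>R ((1 - t) *\<^sub>R h + t *\<^sub>R k)"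
          by (simp add: z_def algebra_simps)
        from min[OF mem_closure mem_closure, OF elim] show ?case
          unfolding eq .
      qed
    qed
    then show ?thesis by simp
  qed
  also have "\<dots> \<le> W ((1 - t) *\<^sub>R x + t *\<^sub>R y) - (1 - t) * W x - t * W y"
    by (rule min[OF xy])
  finally show ?thesis by simp
qed

theorem concave_power:
  "concave_on (closure \<Omega>) (\<lambda>x. ((1 + \<alpha>) * (u x - c)) powr (1 / (1 + \<alpha>)))"
proof -
  have "concave_on (closure \<Omega>) W"
    unfolding concave_on_def
    by (rule convex_onI) (use W_combination in \<open>force simp: algebra_simps\<close>, rule convex_closure[OF conv])
  then show ?thesis
    unfolding W_def expo_def .
qed

end

section \<open>Superlevel sets\<close>

text \<open>
  With \<open>T = -1/r\<close> the hypothesis says that \<open>(1 + r Z)\<^sup>b\<close> dominates the corresponding combination;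
  both sides are \<open>1\<close> at \<open>r = 0\<close>, and the conclusion compares their derivatives there.
\<close>

lemma power_combination_limit:
  fixes X Y Z :: real
  assumes k: "0 < k" and b: "0 < b"
    and le: "\<And>T. T < m \<Longrightarrow>
      (1 - t) * (k * (X - T)) powr b + t * (k * (Y - T)) powr b \<le> (k * (Z - T)) powr b"
  shows "(1 - t) * X + t * Y \<le> Z"
proof (rule ccontr)
  assume neg: "\<not> ?thesis"
  define F where "F r = (1 + r * Z) powr b - (1 - t) * (1 + r * X) powr b - t * (1 + r * Y) powr b" for r
  have der: "((\<lambda>r. (1 + r * V) powr b) has_real_derivative b * V) (at 0)" for V
  proof -
    have "((\<lambda>r. 1 + r * V) has_real_derivative V) (at 0)"
      by (auto intro!: derivative_eq_intros)
    from DERIV_chain2[OF has_real_derivative_powr this, of b] show ?thesis by simp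
  qed
  have "(F has_real_derivative b * Z - (1 - t) * (b * X) - t * (b * Y)) (at 0)"
    unfolding F_def by (intro DERIV_diff DERIV_cmult der)
  moreover have "b * Z - (1 - t) * (b * X) - t * (b * Y) = b * (Z - ((1 - t) * X + t * Y))"
    by (simp add: algebra_simps)
  ultimately obtain d where d: "d > 0" "\<And>r. 0 < r \<Longrightarrow> r < d \<Longrightarrow> F r < F 0"
    using DERIV_neg_dec_right[of F _ 0] neg mult_pos_neg[OF b, of "Z - ((1 - t) * X + t * Y)"] by auto
  \<comment> \<open>With \<open>r \<le> 1 / N\<close> the level \<open>T = -1/r\<close> lies below
    \<open>m\<close> and below \<open>X\<close>, \<open>Y\<close> and \<open>Z\<close>.\<close>
  define N where "N = \<bar>m\<bar> + \<bar>X\<bar> + \<bar>Y\<bar> + \<bar>Z\<bar> + 1"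
  define r where "r = min (d / 2) (1 / N)"
  have N: "0 < N" by (simp add: N_def)
  then have r: "0 < r" "r < d" "r \<le> 1 / N"
    using d(1) by (auto simp: r_def)
  have "N \<le> 1 / r"
    using r N by (simp add: field_simps)
  then have T: "- (1 / r) < m" "0 < X + 1 / r" "0 < Y + 1 / r" "0 < Z + 1 / r"
    by (auto simp: N_def)
  \<comment> \<open>The factor \<open>(k / r) powr b\<close> is common to all three terms and
    cancels.\<close>
  have scale: "(k * (V - - (1 / r))) powr b = (k / r) powr b * (1 + r * V) powr b" if "0 < V + 1 / r" for V
  proof -
    have "k * (V - - (1 / r)) = (k / r) * (1 + r * V)"
      using r(1) by (simp add: field_simps)
    then show ?thesis
      by (simp only: powr_mult)
  qed
  have "(k / r) powr b * ((1 - t) * (1 + r * X) powr b + t * (1 + r * Y) powr b)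
      \<le> (k / r) powr b * (1 + r * Z) powr b"
    using le[OF T(1)] unfolding scale[OF T(2)] scale[OF T(3)] scale[OF T(4)]
    by (simp add: distrib_left mult_ac)
  moreover have "0 < (k / r) powr b"
    using k r by simp
  ultimately have "0 \<le> F r"
    by (simp add: F_def)
  moreover have "F 0 = 0"
    by (simp add: F_def)
  ultimately show False
    using d(2)[OF r(1,2)] by simp
qed

context speed_solution
begin

context
  fixes t :: real and U
  defines "U \<equiv> {x \<in> \<Omega>. t < u x}"
  assumes bot: "q \<in> frontier \<Omega> \<Longrightarrow> filterlim u at_bot (at q within \<Omega>)"
    and t: "t < u p" and bddU: "bounded U"
begin

lemma open_superlevel: "open U"
proof -
  have "U = \<Omega> \<inter> u -` {t<..}" by (auto simp: U_def)
  then show ?thesis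
    using continuous_open_preimage[OF cont_u open_dom open_greaterThan] by simp
qed

text \<open>Since \<open>u\<close> tends to minus infinity at the boundary of the domain,
  \<open>U\<close> cannot accumulate there. Hence \<open>u\<close> and \<open>Du\<close> are
  controlled up to the boundary of \<open>U\<close>.\<close>

lemma closure_superlevel:
  assumes q: "q \<in> closure U"
  shows "q \<in> \<Omega>" "t \<le> u q"
proof -
  show q_in: "q \<in> \<Omega>"
  proof (rule ccontr)
    assume nq: "q \<notin> \<Omega>"
    have "q \<in> closure \<Omega>"
      using q closure_mono[of U \<Omega>] by (auto simp: U_def)
    then have "q \<in> frontier \<Omega>"
      using nq open_dom by (simp add: frontier_def interior_open)
    from bot[OF this] have "\<forall>\<^sub>F x in at q within \<Omega>. u x < t"
      by (simp add: filterlim_at_bot_dense)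
    then obtain d where d: "d > 0" "\<And>x. x \<in> \<Omega> \<Longrightarrow> x \<noteq> q \<Longrightarrow> dist x q < d \<Longrightarrow> u x < t"
      unfolding eventually_at by blast
    obtain y where "y \<in> U" "dist y q < d"
      using q d(1) unfolding closure_approachable by blast
    then show False
      using d(2)[of y] nq by (auto simp: U_def)
  qed
  show "t \<le> u q"
  proof (rule ccontr)
    assume "\<not> t \<le> u q"
    then have "q \<in> \<Omega> \<inter> u -` {..<t}" using q_in by simp
    moreover have "open (\<Omega> \<inter> u -` {..<t})"
      by (rule continuous_open_preimage[OF cont_u open_dom open_lessThan])
    moreover have "(\<Omega> \<inter> u -` {..<t}) \<inter> U = {}"
      by (auto simp: U_def)
    ultimately show False
      using open_Int_closure_eq_empty q by blast
  qed
qed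

lemma continuous_on_closure_superlevel: "continuous_on (closure U) u"
  using continuous_on_subset[OF cont_u] closure_superlevel(1) by blast

text \<open>Each component of a superlevel set contains a maximum point, which has to be \<open>p\<close>.\<close>

lemma superlevel_component:
  assumes "open A" "open V" "A \<inter> V = {}" "p \<in> A" "U = A \<union> V"
  shows "V = {}"
proof (rule ccontr)
  assume ne: "V \<noteq> {}"
  have sub: "closure V \<subseteq> closure U"
    using assms(5) by (intro closure_mono) auto
  have "compact (closure V)"
    using bddU assms(5) by (simp add: bounded_Un)
  then obtain q where q: "q \<in> closure V" "\<And>y. y \<in> closure V \<Longrightarrow> u y \<le> u q"
    using continuous_attains_sup[of "closure V" u] continuous_on_subset[OF continuous_on_closure_superlevel sub] ne
    by auto
  obtain y where y: "y \<in> V" using ne by blast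
  then have "t < u y" using assms(5) by (auto simp: U_def)
  moreover have "u y \<le> u q"
    using q(2) y closure_subset by blast
  ultimately have "q \<in> U"
    using closure_superlevel(1)[OF subsetD[OF sub q(1)]] by (simp add: U_def)
  moreover have "q \<notin> A"
    using open_Int_closure_eq_empty[OF assms(1), of V] assms(3) q(1) by blast
  ultimately have "q \<in> V" using assms(5) by blast
  have "V \<subseteq> \<Omega>" using assms(5) by (auto simp: U_def)
  moreover have "\<forall>y\<in>V. u y \<le> u q"
    using q(2) closure_subset by blast
  ultimately have "q = p"
    using local_extremum_critical[OF assms(2) _ \<open>q \<in> V\<close>] by blast
  with assms(3,4) \<open>q \<in> V\<close> show False by blast
qed

lemma connected_superlevel: "connected U"
  unfolding connected_def
proof (intro notI, elim exE conjE)
  fix A B assume AB: "open A" "open B" "U \<subseteq> A \<union> B" "A \<inter> B \<inter> U = {}" "A \<inter> U \<noteq> {}" "B \<inter> U \<noteq> {}"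
  have o: "open (A \<inter> U)" "open (B \<inter> U)"
    using AB open_superlevel by auto
  have "p \<in> U" using t p_in by (simp add: U_def)
  then consider "p \<in> A \<inter> U" | "p \<in> B \<inter> U" using AB(3) by blast
  then show False
  proof cases
    case 1
    then show False
      using superlevel_component[OF o] AB by blast
  next
    case 2
    then show False
      using superlevel_component[OF o(2) o(1)] AB by blast
  qed
qed

text \<open>
  The points visible from \<open>x\<close> in \<open>U\<close> form a clopen subset: a limit of visible segments that leaves
  \<open>U\<close> touches \<open>{u = t}\<close> from inside, which the curvature of the level sets forbids.
\<close>

lemma convex_superlevel: "convex U"
proof -
  have "closed_segment x y \<subseteq> U" if x: "x \<in> U" and y: "y \<in> U" for x y
  proof -
    define S where "S = {y \<in> U. \<forall>s\<in>{0..1}. x + s *\<^sub>R (y - x) \<in> U}"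
    \<comment> \<open>A compact segment in the open set \<open>U\<close> has a uniform margin
      \<open>e\<close>, and moving the endpoint by less than \<open>e\<close> moves every point of
      the segment by less than \<open>e\<close>.\<close>
    have "open S"
      unfolding open_dist
    proof
      fix y assume y: "y \<in> S"
      let ?K = "(\<lambda>s. x + s *\<^sub>R (y - x)) ` {0..1::real}"
      have "compact ?K"
        by (intro compact_continuous_image continuous_intros) auto
      moreover have "?K \<subseteq> U" using y by (auto simp: S_def)
      ultimately obtain e where e: "e > 0" "(\<Union>w\<in>?K. ball w e) \<subseteq> U"
        using compact_subset_open_imp_ball_epsilon_subset[OF _ open_superlevel] by metis
      show "\<exists>e>0. \<forall>y'. dist y' y < e \<longrightarrow> y' \<in> S"
      proof (intro exI[of _ e] conjI allI impI e(1))
        fix y' assume d: "dist y' y < e"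
        have seg: "x + s *\<^sub>R (y' - x) \<in> U" if s: "s \<in> {0..1}" for s
        proof -
          have "dist (x + s *\<^sub>R (y - x)) (x + s *\<^sub>R (y' - x)) = s * dist y' y"
            using s by (simp add: dist_norm norm_minus_commute flip: scaleR_diff_right)
          also have "\<dots> \<le> 1 * dist y' y"
            using s by (intro mult_right_mono) auto
          finally have "x + s *\<^sub>R (y' - x) \<in> ball (x + s *\<^sub>R (y - x)) e"
            using d by simp
          then show ?thesis using e(2) s by blast
        qed
        from seg[of 1] have "y' \<in> U" by simp
        with seg show "y' \<in> S" by (simp add: S_def)
      qed
    qed
    moreover have "U \<inter> closure S \<subseteq> S"
    proof
      fix y assume y: "y \<in> U \<inter> closure S"
      have ge: "x + s *\<^sub>R (y - x) \<in> closure U" if s: "s \<in> {0..1}" for s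
      proof -
        have "(\<lambda>y. x + s *\<^sub>R (y - x)) ` closure S \<subseteq> closure U"
          by (rule image_closure_subset)
            (use s in \<open>auto intro!: continuous_intros subsetD[OF closure_subset] simp: S_def\<close>)
        then show ?thesis using y by blast
      qed
      have "x + s *\<^sub>R (y - x) \<in> U" if s: "s \<in> {0..1}" for s
      proof (rule ccontr)
        assume nU: "x + s *\<^sub>R (y - x) \<notin> U"
        define z where "z = x + s *\<^sub>R (y - x)"
        have z: "z \<in> \<Omega>" "u z = t"
          using closure_superlevel[OF ge[OF s]] nU by (auto simp: U_def z_def)
        \<comment> \<open>Both endpoints lie in \<open>U\<close>, so \<open>z\<close> is interior to
          the segment and minimises \<open>u\<close> on both sides along the line.\<close>
        have "s \<noteq> 0" "s \<noteq> 1" "y \<noteq> x"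
          using nU x y by auto
        then have s01: "0 < s" "s < 1" using s by auto
        have "\<forall>\<^sub>F r in nhds 0. r \<in> {-s<..<1 - s}"
          using eventually_nhds_in_open[of "{-s<..<1 - s}" 0] s01 by simp
        then have "\<forall>\<^sub>F r in nhds 0. u z \<le> u (z + r *\<^sub>R (y - x))"
        proof eventually_elim
          case (elim r)
          have "z + r *\<^sub>R (y - x) = x + (s + r) *\<^sub>R (y - x)"
            by (simp add: z_def algebra_simps)
          then have "z + r *\<^sub>R (y - x) \<in> closure U"
            using ge[of "s + r"] elim by simp
          then show ?case
            using closure_superlevel(2) z(2) by simp
        qed
        moreover have "z \<noteq> p" using z(2) t by auto
        ultimately show False
          using no_local_min_on_line[OF z(1), of "y - x"] \<open>y \<noteq> x\<close> by simp
      qed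
      then show "y \<in> S" using y by (simp add: S_def)
    qed
    moreover have "S \<subseteq> U" "x \<in> S"
      using x by (auto simp: S_def)
    ultimately have "S = U"
    proof -
      assume S: "open S" "U \<inter> closure S \<subseteq> S" "S \<subseteq> U" "x \<in> S"
      have "openin (top_of_set U) S"
        using S by (simp add: openin_open_eq open_superlevel)
      moreover have "S = U \<inter> closure S"
        using S closure_subset by blast
      then have "closedin (top_of_set U) S"
        by (metis closed_closure closedin_closed)
      ultimately show "S = U"
        using connected_superlevel S(4) unfolding connected_clopen by blast
    qed
    with y have "y \<in> S" by simp
    then have "x + s *\<^sub>R (y - x) \<in> U" if "s \<in> {0..1}" for s
      using that unfolding S_def by blast
    moreover have "(1 - s) *\<^sub>R x + s *\<^sub>R y = x + s *\<^sub>R (y - x)" for s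
      by (simp add: algebra_simps)
    ultimately show ?thesis
      unfolding closed_segment_def by auto
  qed
  then show ?thesis
    by (simp add: convex_contains_segment)
qed

text \<open>This reduces (b) to (a). The boundary of \<open>U\<close> lies in the level set
  \<open>u = t\<close>, which avoids \<open>p\<close> because \<open>t < u p\<close>, so the
  gradient does not vanish on it.\<close>

lemma superlevel_solution:
  assumes "continuous_on \<Omega> Du"
  shows "bounded_speed_solution f \<alpha> U u Du p t"
proof
  have sub: "U \<subseteq> \<Omega>" by (auto simp: U_def)
  show "CARD('m) = CARD('n) + 1" "0 < \<alpha>" "positive_speed f" "monotone_second f" "inverse_concave f"
    by (fact dim alpha_pos speed)+
  show "open U" "convex U" "bounded U" "continuous_on (closure U) u"
    by (fact open_superlevel convex_superlevel bddU continuous_on_closure_superlevel)+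
  show "p \<in> U" using t p_in by (simp add: U_def)
  show "GDERIV u x :> Du x" "Du x = 0 \<longleftrightarrow> x = p" if "x \<in> U" for x
    using that sub grad crit by blast+
  show "Du differentiable (at x)" if "x \<in> U" "x \<noteq> p" for x
    using that sub grad_diff by blast
  show "satisfies_equation f \<alpha> Du (U - {p})"
    using equation sub unfolding satisfies_equation_def by blast
  show "continuous_on (closure U) Du"
    using continuous_on_subset[OF assms] closure_superlevel(1) by blast
  fix x assume x: "x \<in> frontier U"
  then have xc: "x \<in> closure U" "x \<notin> U"
    using open_superlevel by (auto simp: frontier_def interior_open)
  then show "u x = t"
    using closure_superlevel[OF xc(1)] by (simp add: U_def)
  then show "Du x \<noteq> 0"
    using crit closure_superlevel(1)[OF xc(1)] t by auto
qed

end

theorem concave_of_bounded_superlevels: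
  assumes "convex \<Omega>" "continuous_on \<Omega> Du"
    and bot: "\<And>q. q \<in> frontier \<Omega> \<Longrightarrow> filterlim u at_bot (at q within \<Omega>)"
    and bdd: "\<And>t. t < u p \<Longrightarrow> bounded {x \<in> \<Omega>. t < u x}"
  shows "concave_on \<Omega> u"
proof -
  have "(1 - l) * u x + l * u y \<le> u ((1 - l) *\<^sub>R x + l *\<^sub>R y)"
    if l: "0 < l" "l < 1" and xy: "x \<in> \<Omega>" "y \<in> \<Omega>" for l x y
  proof (rule power_combination_limit)
    show "0 < 1 + \<alpha>" "0 < 1 / (1 + \<alpha>)"
      using alpha_pos by auto
    \<comment> \<open>Below \<open>u p\<close> the result for bounded domains applies at level
      \<open>T\<close>; below \<open>u x\<close> and \<open>u y\<close> both points lie in that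
      superlevel set.\<close>
    fix T assume T: "T < min (u p) (min (u x) (u y))"
    then interpret B: bounded_speed_solution f \<alpha> "{x \<in> \<Omega>. T < u x}" u Du p T
      by (intro superlevel_solution bot bdd assms(2)) auto
    have "x \<in> closure {x \<in> \<Omega>. T < u x}" "y \<in> closure {x \<in> \<Omega>. T < u x}"
      using T xy by (auto intro: B.mem_closure)
    from concave_onD[OF B.concave_power _ _ this, of l]
    show "(1 - l) * ((1 + \<alpha>) * (u x - T)) powr (1 / (1 + \<alpha>)) + l * ((1 + \<alpha>) * (u y - T)) powr (1 / (1 + \<alpha>))
       \<le> ((1 + \<alpha>) * (u ((1 - l) *\<^sub>R x + l *\<^sub>R y) - T)) powr (1 / (1 + \<alpha>))"
      using l by simp
  qed
  then show ?thesis
    unfolding concave_on_def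
    by (intro convex_onI assms(1)) (force simp: algebra_simps)
qed

end

theorem theorem3p1:
  fixes f :: "real^'m \<Rightarrow> real^'n^'n \<Rightarrow> real" and \<alpha> :: real
  assumes "CARD('m) = CARD('n) + 1"
    and "\<alpha> > 0"
    and "positive_speed f"
    and "SO_invariant f"
    and "monotone_second f"
    and "inverse_concave f"
  shows
    "(\<forall>(\<Omega>::(real^'m) set) (u::real^'m \<Rightarrow> real) Du p (u0::real).
        bounded \<Omega> \<and> convex \<Omega> \<and> open \<Omega> \<and> smooth_boundary \<Omega> \<and>
        C1_on_closure \<Omega> u Du \<and>
        p \<in> \<Omega> \<and> {x \<in> closure \<Omega>. Du x = 0} = {p} \<and>
        smooth_on (\<Omega> - {p}) u \<and>
        satisfies_equation f \<alpha> Du (\<Omega> - {p}) \<and>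
        (\<forall>x\<in>frontier \<Omega>. u x = u0)
        \<longrightarrow> (\<forall>x\<in>closure \<Omega>. u0 \<le> u x) \<and>
            concave_on (closure \<Omega>) (\<lambda>x. ((1 + \<alpha>) * (u x - u0)) powr (1 / (1 + \<alpha>))))
     \<and>
     (\<forall>(\<Omega>::(real^'m) set) (u::real^'m \<Rightarrow> real) Du p.
        convex \<Omega> \<and> open \<Omega> \<and> smooth_boundary \<Omega> \<and>
        C1_on \<Omega> u Du \<and>
        p \<in> \<Omega> \<and> {x \<in> \<Omega>. Du x = 0} = {p} \<and>
        smooth_on (\<Omega> - {p}) u \<and>
        satisfies_equation f \<alpha> Du (\<Omega> - {p}) \<and>
        (\<forall>q\<in>frontier \<Omega>. filterlim u at_bot (at q within \<Omega>)) \<and>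
        (\<forall>t<u p. bounded {x \<in> \<Omega>. t < u x})
        \<longrightarrow> concave_on \<Omega> u)"
proof (intro conjI[of "\<forall>\<Omega> u Du p u0. P \<Omega> u Du p u0" for P] allI impI, goal_cases)
  case (1 \<Omega> u Du p u0)
  then have A: "bounded \<Omega>" "convex \<Omega>" "open \<Omega>" "\<And>x. x \<in> \<Omega> \<Longrightarrow> GDERIV u x :> Du x"
      "continuous_on (closure \<Omega>) u" "continuous_on (closure \<Omega>) Du"
      "p \<in> \<Omega>" "{x \<in> closure \<Omega>. Du x = 0} = {p}" "smooth_on (\<Omega> - {p}) u"
      "satisfies_equation f \<alpha> Du (\<Omega> - {p})" "\<And>x. x \<in> frontier \<Omega> \<Longrightarrow> u x = u0"
    by (simp_all add: C1_on_closure_def)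
  have crit: "Du x = 0 \<longleftrightarrow> x = p" if "x \<in> closure \<Omega>" for x
    using A(8) that by blast
  interpret bounded_speed_solution f \<alpha> \<Omega> u Du p u0
  proof
    show "Du x = 0 \<longleftrightarrow> x = p" if "x \<in> \<Omega>" for x
      using crit that closure_subset by blast
    show "Du differentiable (at x)" if "x \<in> \<Omega>" "x \<noteq> p" for x
      using smooth_imp_gradient_differentiable[of "\<Omega> - {p}" u Du x] A(3,4,9) that by (simp add: open_delete)
    show "Du x \<noteq> 0" if "x \<in> frontier \<Omega>" for x
      using crit[of x] that A(3,7) by (auto simp: frontier_def interior_open)
  qed (use assms A in auto)
  \<comment> \<open>The lower bound makes the base of \<open>powr\<close> non-negative, so the
    concave function is the genuine real power.\<close>
  show ?case
    using ge_boundary_value concave_power by blast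
next
  case (2 \<Omega> u Du p)
  then have A: "convex \<Omega>" "open \<Omega>" "\<And>x. x \<in> \<Omega> \<Longrightarrow> GDERIV u x :> Du x" "continuous_on \<Omega> Du"
      "p \<in> \<Omega>" "{x \<in> \<Omega>. Du x = 0} = {p}" "smooth_on (\<Omega> - {p}) u"
      "satisfies_equation f \<alpha> Du (\<Omega> - {p})"
      "\<And>q. q \<in> frontier \<Omega> \<Longrightarrow> filterlim u at_bot (at q within \<Omega>)"
      "\<And>t. t < u p \<Longrightarrow> bounded {x \<in> \<Omega>. t < u x}"
    by (simp_all add: C1_on_def)
  interpret speed_solution f \<alpha> \<Omega> u Du p
  proof
    show "Du x = 0 \<longleftrightarrow> x = p" if "x \<in> \<Omega>" for x
      using A(6) that by blast
    show "Du differentiable (at x)" if "x \<in> \<Omega>" "x \<noteq> p" for x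
      using smooth_imp_gradient_differentiable[of "\<Omega> - {p}" u Du x] A(2,3,7) that by (simp add: open_delete)
  qed (use assms A in auto)
  show ?case
    by (rule concave_of_bounded_superlevels) (use A in auto)
qed

end
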